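(* Let $\Pi$ be a group and let $A$ be a $\Pi$-subsemimodule of a $\Pi$-module $C$ such that $K(A)=C$. If $H^3(\Pi,A)=0$, then any abstract kernel $(\Pi,G,\psi)$ with centre $C$ whose obstruction class $\mathrm{Obs}(\Pi,G,\psi)$ contains a $3$-cocycle of $\Pi$ with values in $A$ has an extension.
   Context: A $\Pi$-semimodule is an abelian monoid $(A,+,0)$ with a left action of $\Pi$ by monoid endomorphisms: $x(a+a')=xa+xa'$, $x0=0$, $(xy)a=x(ya)$, $1a=a$. It is a $\Pi$-module if $(A,+,0)$ is a group. A $\Pi$-subsemimodule of a $\Pi$-module $C$ is a submonoid stable under the $\Pi$-action; $K(A)=C$ means that $C$ is the group completion of $A$, i.e. every element of $C$ has the form $a_1-a_2$ with $a_1,a_2\in A$. **Cohomology monoid $H^3(\Pi,A)$.** A $3$-cocycle with values in a $\Pi$-semimodule $A$ is a function $f:\Pi^3\to A$ which vanishes whenever one of its arguments is $1$ and satisfies $$x_1f(x_2,x_3,x_4)+f(x_1,x_2x_3,x_4)+f(x_1,x_2,x_3)=f(x_1x_2,x_3,x_4)+f(x_1,x_2,x_3x_4)$$ for all $x_i\in\Pi$. Two $3$-cocycles $f,f'$ are identified if there are functions $g_1,g_2:\Pi^2\to A$, vanishing whenever one of their arguments is $1$, such that for all $x,y,z\in\Pi$ $$f(x,y,z)+g_1(xy,z)+g_1(x,y)+xg_2(y,z)+g_2(x,yz)=f'(x,y,z)+g_2(xy,z)+g_2(x,y)+xg_1(y,z)+g_1(x,yz).$$ $H^3(\Pi,A)$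 is the resulting quotient monoid of the abelian monoid of $3$-cocycles (under pointwise addition). $H^3(\Pi,A)=0$ means that it has exactly one element. For a $\Pi$-module $C$, $H^3(\Pi,C)$ is the usual (normalized) group cohomology. **Abstract kernels.** An abstract kernel is a triple $(\Pi,G,\psi)$ with $\Pi,G$ groups ($G$ written additively, not necessarily abelian) and $\psi:\Pi\to\mathrm{Aut}(G)/\mathrm{In}(G)$ a group homomorphism, where $\mathrm{In}(G)$ is the group of inner automorphisms $\mu_g(h)=g+h-g$. The centre of the group $G$ is a $\Pi$-module via $xc=\varphi(x)(c)$ for any $\varphi(x)\in\psi(x)$; this $\Pi$-module is called the centre of $(\Pi,G,\psi)$. A group extension $1\to G\to B\to\Pi\to1$ induces, by conjugation in $B$, a homomorphism $\Pi\to\mathrm{Aut}(G)/\mathrm{In}(G)$. The abstract kernel has an extension if there is such a group extension whose induced homomorphism is $\psi$. **Obstruction class (Eilenberg–Mac Lane).** Choose $\varphi(x)\in\psi(x)$ with $\varphi(1)=1$, and $f(x,y)\in G$ with $\varphi(x)\varphi(y)=\mu_{f(x,y)}\varphi(xy)$ and $f(x,1)=0=f(1,y)$. Then there is a unique $3$-cocycle $k:\Pi^3\to C$ ($C$ the centre of the abstract kernel) with $\varphi(x)(f(y,z))+f(x,yz)=k(x,y,z)+f(x,y)+f(xy,z)$ for all $x,y,z\in\Pi$. Its class $\mathrm{Obs}(\Pi,G,\psi)=cl(k)\in H^3(\Pi,C)$ does not depend on the choices made. *)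

theory Defs
  imports "HOL-Algebra.Coset" "HOL-Algebra.Bij"
begin

text \<open>
  All groups and monoids are records of type \<open>monoid\<close> and are written
  multiplicatively, including those which are usually written additively
  (semimodules and the kernel \<open>G\<close> of an extension). The operator group is called \<open>P\<close>.
\<close>

section \<open>Semimodules over a group\<close>

locale group_semimodule = P?: group P + A?: comm_monoid A
  for P (structure) and A (structure) +
  fixes act :: "'p \<Rightarrow> 'a \<Rightarrow> 'a"
  constrains P :: "('p, 'm) monoid_scheme" and A :: "('a, 'n) monoid_scheme"
  assumes act_closed: "\<lbrakk>x \<in> carrier P; a \<in> carrier A\<rbrakk> \<Longrightarrow> act x a \<in> carrier A"
    and act_mult: "\<lbrakk>x \<in> carrier P; a \<in> carrier A; b \<in> carrier A\<rbrakk>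
      \<Longrightarrow> act x (a \<otimes>\<^bsub>A\<^esub> b) = act x a \<otimes>\<^bsub>A\<^esub> act x b"
    and act_zero: "x \<in> carrier P \<Longrightarrow> act x \<one>\<^bsub>A\<^esub> = \<one>\<^bsub>A\<^esub>"
    and act_comp: "\<lbrakk>x \<in> carrier P; y \<in> carrier P; a \<in> carrier A\<rbrakk>
      \<Longrightarrow> act (x \<otimes>\<^bsub>P\<^esub> y) a = act x (act y a)"
    and act_one: "a \<in> carrier A \<Longrightarrow> act \<one>\<^bsub>P\<^esub> a = a"

locale group_module = group_semimodule P A act + A?: comm_group A
  for P (structure) and A (structure) and act

text \<open>The subsemimodule with underlying set \<open>S\<close> is the record \<open>C\<lparr>carrier := S\<rparr>\<close>
  with the same action.\<close>

definition subsemimodule ::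
    "('p, 'm) monoid_scheme \<Rightarrow> 'c set \<Rightarrow> ('c, 'n) monoid_scheme \<Rightarrow> ('p \<Rightarrow> 'c \<Rightarrow> 'c) \<Rightarrow> bool"
  where "subsemimodule P S C act \<longleftrightarrow>
    submonoid S C \<and> (\<forall>x\<in>carrier P. \<forall>a\<in>S. act x a \<in> S)"

lemma subsemimodule_is_semimodule:
  assumes "group_semimodule P C act" "subsemimodule P S C act"
  shows "group_semimodule P (C\<lparr>carrier := S\<rparr>) act"
proof -
  interpret group_semimodule P C act by fact
  interpret S: submonoid S C using assms(2) by (simp add: subsemimodule_def)
  have "comm_monoid (C\<lparr>carrier := S\<rparr>)"
    by (rule comm_monoidI) (auto simp: A.m_assoc S.mem_carrier intro: A.m_comm)
  then show ?thesis
    using assms(2)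
    by (intro group_semimodule.intro group_semimodule_axioms.intro P.is_group)
       (auto simp: subsemimodule_def S.mem_carrier act_mult act_zero act_comp act_one)
qed

definition group_completion_of :: "('c, 'n) monoid_scheme \<Rightarrow> 'c set \<Rightarrow> bool"
  where "group_completion_of C S \<longleftrightarrow>
    (\<forall>c\<in>carrier C. \<exists>a\<in>S. \<exists>b\<in>S. c = a \<otimes>\<^bsub>C\<^esub> inv\<^bsub>C\<^esub> b)"

definition module_iso ::
    "('p, 'm) monoid_scheme \<Rightarrow> ('c, 'n) monoid_scheme \<Rightarrow> ('p \<Rightarrow> 'c \<Rightarrow> 'c)
      \<Rightarrow> ('d, 'k) monoid_scheme \<Rightarrow> ('p \<Rightarrow> 'd \<Rightarrow> 'd) \<Rightarrow> ('c \<Rightarrow> 'd) set"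
  where "module_iso P C act D act' =
    {j \<in> iso C D. \<forall>x\<in>carrier P. \<forall>c\<in>carrier C. j (act x c) = act' x (j c)}"


section \<open>The third cohomology monoid\<close>

text \<open>Cochains are extensional on the carrier of \<open>P\<close>, so that two cochains are
  equal in HOL iff they agree on \<open>P\<close>.\<close>

definition cochains2 ::
    "('p, 'm) monoid_scheme \<Rightarrow> ('a, 'n) monoid_scheme \<Rightarrow> ('p \<times> 'p \<Rightarrow> 'a) set"
  where "cochains2 P A =
    {g \<in> carrier P \<times> carrier P \<rightarrow>\<^sub>E carrier A.
      \<forall>x\<in>carrier P. g (x, \<one>\<^bsub>P\<^esub>) = \<one>\<^bsub>A\<^esub> \<and> g (\<one>\<^bsub>P\<^esub>, x) = \<one>\<^bsub>A\<^esub>}"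

definition cochains3 ::
    "('p, 'm) monoid_scheme \<Rightarrow> ('a, 'n) monoid_scheme \<Rightarrow> ('p \<times> 'p \<times> 'p \<Rightarrow> 'a) set"
  where "cochains3 P A =
    {f \<in> carrier P \<times> carrier P \<times> carrier P \<rightarrow>\<^sub>E carrier A.
      \<forall>x\<in>carrier P. \<forall>y\<in>carrier P.
        f (\<one>\<^bsub>P\<^esub>, x, y) = \<one>\<^bsub>A\<^esub> \<and> f (x, \<one>\<^bsub>P\<^esub>, y) = \<one>\<^bsub>A\<^esub> \<and> f (x, y, \<one>\<^bsub>P\<^esub>) = \<one>\<^bsub>A\<^esub>}"

definition cocycles3 ::
    "('p, 'm) monoid_scheme \<Rightarrow> ('a, 'n) monoid_scheme \<Rightarrow> ('p \<Rightarrow> 'a \<Rightarrow> 'a)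
      \<Rightarrow> ('p \<times> 'p \<times> 'p \<Rightarrow> 'a) set"
  where "cocycles3 P A act =
    {f \<in> cochains3 P A.
      \<forall>x1\<in>carrier P. \<forall>x2\<in>carrier P. \<forall>x3\<in>carrier P. \<forall>x4\<in>carrier P.
        act x1 (f (x2, x3, x4)) \<otimes>\<^bsub>A\<^esub> f (x1, x2 \<otimes>\<^bsub>P\<^esub> x3, x4) \<otimes>\<^bsub>A\<^esub> f (x1, x2, x3)
        = f (x1 \<otimes>\<^bsub>P\<^esub> x2, x3, x4) \<otimes>\<^bsub>A\<^esub> f (x1, x2, x3 \<otimes>\<^bsub>P\<^esub> x4)}"

definition cohomologous3 ::
    "('p, 'm) monoid_scheme \<Rightarrow> ('a, 'n) monoid_scheme \<Rightarrow> ('p \<Rightarrow> 'a \<Rightarrow> 'a)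
      \<Rightarrow> (('p \<times> 'p \<times> 'p \<Rightarrow> 'a) \<times> ('p \<times> 'p \<times> 'p \<Rightarrow> 'a)) set"
  where "cohomologous3 P A act =
    {(f, f'). f \<in> cocycles3 P A act \<and> f' \<in> cocycles3 P A act \<and>
      (\<exists>g1\<in>cochains2 P A. \<exists>g2\<in>cochains2 P A.
        \<forall>x\<in>carrier P. \<forall>y\<in>carrier P. \<forall>z\<in>carrier P.
          f (x, y, z) \<otimes>\<^bsub>A\<^esub> g1 (x \<otimes>\<^bsub>P\<^esub> y, z) \<otimes>\<^bsub>A\<^esub> g1 (x, y)
            \<otimes>\<^bsub>A\<^esub> act x (g2 (y, z)) \<otimes>\<^bsub>A\<^esub> g2 (x, y \<otimes>\<^bsub>P\<^esub> z)
          = f' (x, y, z) \<otimes>\<^bsub>A\<^esub> g2 (x \<otimes>\<^bsub>P\<^esub> y, z) \<otimes>\<^bsub>A\<^esub> g2 (x, y)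
            \<otimes>\<^bsub>A\<^esub> act x (g1 (y, z)) \<otimes>\<^bsub>A\<^esub> g1 (x, y \<otimes>\<^bsub>P\<^esub> z))}"

definition cochain3_mult ::
    "('p, 'm) monoid_scheme \<Rightarrow> ('a, 'n) monoid_scheme
      \<Rightarrow> ('p \<times> 'p \<times> 'p \<Rightarrow> 'a) \<Rightarrow> ('p \<times> 'p \<times> 'p \<Rightarrow> 'a) \<Rightarrow> ('p \<times> 'p \<times> 'p \<Rightarrow> 'a)"
  where "cochain3_mult P A f f' =
    (\<lambda>t\<in>carrier P \<times> carrier P \<times> carrier P. f t \<otimes>\<^bsub>A\<^esub> f' t)"

definition cochain3_one ::
    "('p, 'm) monoid_scheme \<Rightarrow> ('a, 'n) monoid_scheme \<Rightarrow> ('p \<times> 'p \<times> 'p \<Rightarrow> 'a)"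
  where "cochain3_one P A = (\<lambda>t\<in>carrier P \<times> carrier P \<times> carrier P. \<one>\<^bsub>A\<^esub>)"

definition H3 ::
    "('p, 'm) monoid_scheme \<Rightarrow> ('a, 'n) monoid_scheme \<Rightarrow> ('p \<Rightarrow> 'a \<Rightarrow> 'a)
      \<Rightarrow> ('p \<times> 'p \<times> 'p \<Rightarrow> 'a) set monoid"
  where "H3 P A act =
    \<lparr>carrier = cocycles3 P A act // cohomologous3 P A act,
     mult = (\<lambda>X Y. cohomologous3 P A act `` {cochain3_mult P A f f' | f f'. f \<in> X \<and> f' \<in> Y}),
     one = cohomologous3 P A act `` {cochain3_one P A}\<rparr>"


lemma (in group_semimodule) equiv_cohomologous3:
  "equiv (cocycles3 P A act) (cohomologous3 P A act)"
proof (rule equivI)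
  show "cohomologous3 P A act \<subseteq> cocycles3 P A act \<times> cocycles3 P A act"
    by (auto simp: cohomologous3_def)
  show "refl_on (cocycles3 P A act) (cohomologous3 P A act)"
  proof (rule refl_onI)
    fix f assume f: "f \<in> cocycles3 P A act"
    let ?g = "\<lambda>t\<in>carrier P \<times> carrier P. \<one>\<^bsub>A\<^esub>"
    have "?g \<in> cochains2 P A" by (simp add: cochains2_def)
    with f show "(f, f) \<in> cohomologous3 P A act"
      unfolding cohomologous3_def by blast
  qed
  show "sym (cohomologous3 P A act)"
  proof (rule symI)
    fix f f' assume "(f, f') \<in> cohomologous3 P A act"
    then obtain g1 g2 where "f \<in> cocycles3 P A act" "f' \<in> cocycles3 P A act"
      "g1 \<in> cochains2 P A" "g2 \<in> cochains2 P A"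
      "\<forall>x\<in>carrier P. \<forall>y\<in>carrier P. \<forall>z\<in>carrier P.
          f' (x, y, z) \<otimes>\<^bsub>A\<^esub> g2 (x \<otimes>\<^bsub>P\<^esub> y, z) \<otimes>\<^bsub>A\<^esub> g2 (x, y)
            \<otimes>\<^bsub>A\<^esub> act x (g1 (y, z)) \<otimes>\<^bsub>A\<^esub> g1 (x, y \<otimes>\<^bsub>P\<^esub> z)
          = f (x, y, z) \<otimes>\<^bsub>A\<^esub> g1 (x \<otimes>\<^bsub>P\<^esub> y, z) \<otimes>\<^bsub>A\<^esub> g1 (x, y)
            \<otimes>\<^bsub>A\<^esub> act x (g2 (y, z)) \<otimes>\<^bsub>A\<^esub> g2 (x, y \<otimes>\<^bsub>P\<^esub> z)"
      by (auto simp: cohomologous3_def)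
    then show "(f', f) \<in> cohomologous3 P A act"
      unfolding cohomologous3_def by blast
  qed
  show "trans (cohomologous3 P A act)"
  proof (rule transI)
    fix f f' f''
    assume "(f, f') \<in> cohomologous3 P A act" "(f', f'') \<in> cohomologous3 P A act"
    then obtain g1 g2 h1 h2 where
      f: "f \<in> cocycles3 P A act" "f' \<in> cocycles3 P A act" "f'' \<in> cocycles3 P A act"
      and g: "g1 \<in> cochains2 P A" "g2 \<in> cochains2 P A" "h1 \<in> cochains2 P A" "h2 \<in> cochains2 P A"
      and e1: "\<And>x y z. x \<in> carrier P \<Longrightarrow> y \<in> carrier P \<Longrightarrow> z \<in> carrier P \<Longrightarrow>
          f (x, y, z) \<otimes>\<^bsub>A\<^esub> g1 (x \<otimes>\<^bsub>P\<^esub> y, z) \<otimes>\<^bsub>A\<^esub> g1 (x, y)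
            \<otimes>\<^bsub>A\<^esub> act x (g2 (y, z)) \<otimes>\<^bsub>A\<^esub> g2 (x, y \<otimes>\<^bsub>P\<^esub> z)
          = f' (x, y, z) \<otimes>\<^bsub>A\<^esub> g2 (x \<otimes>\<^bsub>P\<^esub> y, z) \<otimes>\<^bsub>A\<^esub> g2 (x, y)
            \<otimes>\<^bsub>A\<^esub> act x (g1 (y, z)) \<otimes>\<^bsub>A\<^esub> g1 (x, y \<otimes>\<^bsub>P\<^esub> z)"
      and e2: "\<And>x y z. x \<in> carrier P \<Longrightarrow> y \<in> carrier P \<Longrightarrow> z \<in> carrier P \<Longrightarrow>
          f' (x, y, z) \<otimes>\<^bsub>A\<^esub> h1 (x \<otimes>\<^bsub>P\<^esub> y, z) \<otimes>\<^bsub>A\<^esub> h1 (x, y)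
            \<otimes>\<^bsub>A\<^esub> act x (h2 (y, z)) \<otimes>\<^bsub>A\<^esub> h2 (x, y \<otimes>\<^bsub>P\<^esub> z)
          = f'' (x, y, z) \<otimes>\<^bsub>A\<^esub> h2 (x \<otimes>\<^bsub>P\<^esub> y, z) \<otimes>\<^bsub>A\<^esub> h2 (x, y)
            \<otimes>\<^bsub>A\<^esub> act x (h1 (y, z)) \<otimes>\<^bsub>A\<^esub> h1 (x, y \<otimes>\<^bsub>P\<^esub> z)"
      by (auto simp: cohomologous3_def)
    define k1 where "k1 = (\<lambda>t\<in>carrier P \<times> carrier P. g1 t \<otimes>\<^bsub>A\<^esub> h1 t)"
    define k2 where "k2 = (\<lambda>t\<in>carrier P \<times> carrier P. g2 t \<otimes>\<^bsub>A\<^esub> h2 t)"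
    have c2: "g (x, y) \<in> carrier A"
      if "g \<in> cochains2 P A" "x \<in> carrier P" "y \<in> carrier P" for g x y
      using that by (auto simp: cochains2_def)
    have c3: "g (x, y, z) \<in> carrier A"
      if "g \<in> cocycles3 P A act" "x \<in> carrier P" "y \<in> carrier P" "z \<in> carrier P" for g x y z
      using that by (auto simp: cocycles3_def cochains3_def)
    have k: "k1 \<in> cochains2 P A" "k2 \<in> cochains2 P A"
      using g by (auto simp: cochains2_def k1_def k2_def)
    have "f (x, y, z) \<otimes>\<^bsub>A\<^esub> k1 (x \<otimes>\<^bsub>P\<^esub> y, z) \<otimes>\<^bsub>A\<^esub> k1 (x, y)
            \<otimes>\<^bsub>A\<^esub> act x (k2 (y, z)) \<otimes>\<^bsub>A\<^esub> k2 (x, y \<otimes>\<^bsub>P\<^esub> z)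
          = f'' (x, y, z) \<otimes>\<^bsub>A\<^esub> k2 (x \<otimes>\<^bsub>P\<^esub> y, z) \<otimes>\<^bsub>A\<^esub> k2 (x, y)
            \<otimes>\<^bsub>A\<^esub> act x (k1 (y, z)) \<otimes>\<^bsub>A\<^esub> k1 (x, y \<otimes>\<^bsub>P\<^esub> z)" (is "?l = ?r")
      if xyz: "x \<in> carrier P" "y \<in> carrier P" "z \<in> carrier P" for x y z
    proof -
      note cs = c2[OF g(1)] c2[OF g(2)] c2[OF g(3)] c2[OF g(4)]
        c3[OF f(1)] c3[OF f(2)] c3[OF f(3)] act_closed act_mult xyz
      have "?l = f (x, y, z) \<otimes>\<^bsub>A\<^esub> g1 (x \<otimes>\<^bsub>P\<^esub> y, z) \<otimes>\<^bsub>A\<^esub> g1 (x, y)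
            \<otimes>\<^bsub>A\<^esub> act x (g2 (y, z)) \<otimes>\<^bsub>A\<^esub> g2 (x, y \<otimes>\<^bsub>P\<^esub> z)
         \<otimes>\<^bsub>A\<^esub> (h1 (x \<otimes>\<^bsub>P\<^esub> y, z) \<otimes>\<^bsub>A\<^esub> h1 (x, y)
            \<otimes>\<^bsub>A\<^esub> act x (h2 (y, z)) \<otimes>\<^bsub>A\<^esub> h2 (x, y \<otimes>\<^bsub>P\<^esub> z))"
        by (simp add: k1_def k2_def cs A.m_ac)
      also have "\<dots> = (f' (x, y, z) \<otimes>\<^bsub>A\<^esub> h1 (x \<otimes>\<^bsub>P\<^esub> y, z) \<otimes>\<^bsub>A\<^esub> h1 (x, y)
            \<otimes>\<^bsub>A\<^esub> act x (h2 (y, z)) \<otimes>\<^bsub>A\<^esub> h2 (x, y \<otimes>\<^bsub>P\<^esub> z))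
          \<otimes>\<^bsub>A\<^esub> (g2 (x \<otimes>\<^bsub>P\<^esub> y, z) \<otimes>\<^bsub>A\<^esub> g2 (x, y)
            \<otimes>\<^bsub>A\<^esub> act x (g1 (y, z)) \<otimes>\<^bsub>A\<^esub> g1 (x, y \<otimes>\<^bsub>P\<^esub> z))"
        by (subst e1) (simp_all add: cs A.m_ac)
      also have "\<dots> = ?r"
        by (subst e2) (simp_all add: k1_def k2_def cs A.m_ac)
      finally show ?thesis .
    qed
    with f k show "(f, f'') \<in> cohomologous3 P A act"
      unfolding cohomologous3_def by blast
  qed
qed

text \<open>Over a module the identification of cocycles is the usual one.\<close>

lemma (in group_module) cohomologous3_iff:
  "(f, f') \<in> cohomologous3 P A act \<longleftrightarrow>
    f \<in> cocycles3 P A act \<and> f' \<in> cocycles3 P A act \<and>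
    (\<exists>g\<in>cochains2 P A. \<forall>x\<in>carrier P. \<forall>y\<in>carrier P. \<forall>z\<in>carrier P.
      f (x, y, z) \<otimes>\<^bsub>A\<^esub> act x (g (y, z)) \<otimes>\<^bsub>A\<^esub> g (x, y \<otimes>\<^bsub>P\<^esub> z)
      = f' (x, y, z) \<otimes>\<^bsub>A\<^esub> g (x \<otimes>\<^bsub>P\<^esub> y, z) \<otimes>\<^bsub>A\<^esub> g (x, y))" (is "?l \<longleftrightarrow> ?r")
proof
  have c2: "g (x, y) \<in> carrier A"
    if "g \<in> cochains2 P A" "x \<in> carrier P" "y \<in> carrier P" for g x y
    using that by (auto simp: cochains2_def)
  have c3: "g (x, y, z) \<in> carrier A"
    if "g \<in> cocycles3 P A act" "x \<in> carrier P" "y \<in> carrier P" "z \<in> carrier P" for g x y z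
    using that by (auto simp: cocycles3_def cochains3_def)
  {
    assume ?l
    then obtain g1 g2 where f: "f \<in> cocycles3 P A act" "f' \<in> cocycles3 P A act"
      and g: "g1 \<in> cochains2 P A" "g2 \<in> cochains2 P A"
      and e: "\<And>x y z. x \<in> carrier P \<Longrightarrow> y \<in> carrier P \<Longrightarrow> z \<in> carrier P \<Longrightarrow>
          f (x, y, z) \<otimes>\<^bsub>A\<^esub> g1 (x \<otimes>\<^bsub>P\<^esub> y, z) \<otimes>\<^bsub>A\<^esub> g1 (x, y)
            \<otimes>\<^bsub>A\<^esub> act x (g2 (y, z)) \<otimes>\<^bsub>A\<^esub> g2 (x, y \<otimes>\<^bsub>P\<^esub> z)
          = f' (x, y, z) \<otimes>\<^bsub>A\<^esub> g2 (x \<otimes>\<^bsub>P\<^esub> y, z) \<otimes>\<^bsub>A\<^esub> g2 (x, y)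
            \<otimes>\<^bsub>A\<^esub> act x (g1 (y, z)) \<otimes>\<^bsub>A\<^esub> g1 (x, y \<otimes>\<^bsub>P\<^esub> z)"
      by (auto simp: cohomologous3_def)
    define h where "h = (\<lambda>t\<in>carrier P \<times> carrier P. g2 t \<otimes>\<^bsub>A\<^esub> inv\<^bsub>A\<^esub> g1 t)"
    have h: "h \<in> cochains2 P A" using g by (auto simp: cochains2_def h_def)
    have g2: "g2 (x, y) = h (x, y) \<otimes>\<^bsub>A\<^esub> g1 (x, y)" if "x \<in> carrier P" "y \<in> carrier P" for x y
      using that c2 [OF g(1) that] c2 [OF g(2) that] by (simp add: h_def A.m_assoc)
    have "f (x, y, z) \<otimes>\<^bsub>A\<^esub> act x (h (y, z)) \<otimes>\<^bsub>A\<^esub> h (x, y \<otimes>\<^bsub>P\<^esub> z)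
        = f' (x, y, z) \<otimes>\<^bsub>A\<^esub> h (x \<otimes>\<^bsub>P\<^esub> y, z) \<otimes>\<^bsub>A\<^esub> h (x, y)" (is "?a = ?b")
      if xyz: "x \<in> carrier P" "y \<in> carrier P" "z \<in> carrier P" for x y z
    proof -
      note cs = c2 [OF g(1)] c2 [OF h] c3 [OF f(1)] c3 [OF f(2)] act_closed act_mult xyz
      let ?K = "g1 (x \<otimes>\<^bsub>P\<^esub> y, z) \<otimes>\<^bsub>A\<^esub> g1 (x, y)
        \<otimes>\<^bsub>A\<^esub> act x (g1 (y, z)) \<otimes>\<^bsub>A\<^esub> g1 (x, y \<otimes>\<^bsub>P\<^esub> z)"
      have "?a \<otimes>\<^bsub>A\<^esub> ?K = ?b \<otimes>\<^bsub>A\<^esub> ?K"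
        using e [OF xyz] by (simp add: g2 cs A.m_ac)
      then show ?thesis by (simp add: cs)
    qed
    with f h show ?r by blast
  next
    assume ?r
    then obtain g where f: "f \<in> cocycles3 P A act" "f' \<in> cocycles3 P A act"
      and g: "g \<in> cochains2 P A"
      and e: "\<And>x y z. x \<in> carrier P \<Longrightarrow> y \<in> carrier P \<Longrightarrow> z \<in> carrier P \<Longrightarrow>
        f (x, y, z) \<otimes>\<^bsub>A\<^esub> act x (g (y, z)) \<otimes>\<^bsub>A\<^esub> g (x, y \<otimes>\<^bsub>P\<^esub> z)
        = f' (x, y, z) \<otimes>\<^bsub>A\<^esub> g (x \<otimes>\<^bsub>P\<^esub> y, z) \<otimes>\<^bsub>A\<^esub> g (x, y)"
      by blast
    define u where "u = (\<lambda>t\<in>carrier P \<times> carrier P. \<one>\<^bsub>A\<^esub>)"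
    have u: "u \<in> cochains2 P A" by (simp add: cochains2_def u_def)
    have "\<forall>x\<in>carrier P. \<forall>y\<in>carrier P. \<forall>z\<in>carrier P.
          f (x, y, z) \<otimes>\<^bsub>A\<^esub> u (x \<otimes>\<^bsub>P\<^esub> y, z) \<otimes>\<^bsub>A\<^esub> u (x, y)
            \<otimes>\<^bsub>A\<^esub> act x (g (y, z)) \<otimes>\<^bsub>A\<^esub> g (x, y \<otimes>\<^bsub>P\<^esub> z)
          = f' (x, y, z) \<otimes>\<^bsub>A\<^esub> g (x \<otimes>\<^bsub>P\<^esub> y, z) \<otimes>\<^bsub>A\<^esub> g (x, y)
            \<otimes>\<^bsub>A\<^esub> act x (u (y, z)) \<otimes>\<^bsub>A\<^esub> u (x, y \<otimes>\<^bsub>P\<^esub> z)"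
      using e by (simp add: u_def act_zero c2 [OF g] c3 [OF f(1)] c3 [OF f(2)] act_closed)
    with f g u show ?l unfolding cohomologous3_def by blast
  }
qed


section \<open>Abstract kernels\<close>

definition inner_aut :: "('g, 'm) monoid_scheme \<Rightarrow> 'g \<Rightarrow> ('g \<Rightarrow> 'g)"
  where "inner_aut G g = (\<lambda>h\<in>carrier G. g \<otimes>\<^bsub>G\<^esub> h \<otimes>\<^bsub>G\<^esub> inv\<^bsub>G\<^esub> g)"

definition Inn :: "('g, 'm) monoid_scheme \<Rightarrow> ('g \<Rightarrow> 'g) set"
  where "Inn G = inner_aut G ` carrier G"

definition OutGroup :: "('g, 'm) monoid_scheme \<Rightarrow> ('g \<Rightarrow> 'g) set monoid"
  where "OutGroup G = AutoGroup G Mod Inn G"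

locale abstract_kernel = P?: group P + G?: group G
  for P (structure) and G (structure) +
  fixes \<psi> :: "'p \<Rightarrow> ('g \<Rightarrow> 'g) set"
  constrains P :: "('p, 'm) monoid_scheme" and G :: "('g, 'n) monoid_scheme"
  assumes psi_hom: "\<psi> \<in> hom P (OutGroup G)"

definition centre :: "('g, 'm) monoid_scheme \<Rightarrow> 'g set"
  where "centre G = {c \<in> carrier G. \<forall>g\<in>carrier G. c \<otimes>\<^bsub>G\<^esub> g = g \<otimes>\<^bsub>G\<^esub> c}"

abbreviation centre_group :: "('g, 'm) monoid_scheme \<Rightarrow> ('g, 'm) monoid_scheme"
  where "centre_group G \<equiv> G\<lparr>carrier := centre G\<rparr>"

text \<open>The value does not depend on the representative of \<open>\<psi> x\<close>; see
  \<open>centre_act_eq\<close> below.\<close>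

definition centre_act :: "('p \<Rightarrow> ('g \<Rightarrow> 'g) set) \<Rightarrow> 'p \<Rightarrow> 'g \<Rightarrow> 'g"
  where "centre_act \<psi> x c = (SOME \<alpha>. \<alpha> \<in> \<psi> x) c"


lemma centre_closed: "c \<in> centre G \<Longrightarrow> c \<in> carrier G"
  by (simp add: centre_def)

lemma centre_comm: "\<lbrakk>c \<in> centre G; g \<in> carrier G\<rbrakk> \<Longrightarrow> c \<otimes>\<^bsub>G\<^esub> g = g \<otimes>\<^bsub>G\<^esub> c"
  unfolding centre_def by blast

lemma centreI:
  "\<lbrakk>c \<in> carrier G; \<And>g. g \<in> carrier G \<Longrightarrow> c \<otimes>\<^bsub>G\<^esub> g = g \<otimes>\<^bsub>G\<^esub> c\<rbrakk> \<Longrightarrow> c \<in> centre G"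
  unfolding centre_def by blast

lemma carrier_AutoGroup [simp]: "carrier (AutoGroup G) = auto G"
  by (simp add: AutoGroup_def)

lemma one_AutoGroup: "\<one>\<^bsub>AutoGroup G\<^esub> = (\<lambda>x\<in>carrier G. x)"
  by (simp add: AutoGroup_def BijGroup_def)

lemma mult_AutoGroup:
  "\<lbrakk>\<alpha> \<in> auto G; \<beta> \<in> auto G\<rbrakk> \<Longrightarrow> \<alpha> \<otimes>\<^bsub>AutoGroup G\<^esub> \<beta> = compose (carrier G) \<alpha> \<beta>"
  by (simp add: AutoGroup_def BijGroup_def auto_def)

lemma auto_closed: "\<lbrakk>\<alpha> \<in> auto G; g \<in> carrier G\<rbrakk> \<Longrightarrow> \<alpha> g \<in> carrier G"
  by (auto simp: auto_def hom_def)

lemma auto_mult: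
  "\<lbrakk>\<alpha> \<in> auto G; g \<in> carrier G; h \<in> carrier G\<rbrakk> \<Longrightarrow> \<alpha> (g \<otimes>\<^bsub>G\<^esub> h) = \<alpha> g \<otimes>\<^bsub>G\<^esub> \<alpha> h"
  by (auto simp: auto_def hom_def)

lemma auto_eqI:
  assumes "\<alpha> \<in> auto G" "\<beta> \<in> auto G" "\<And>g. g \<in> carrier G \<Longrightarrow> \<alpha> g = \<beta> g"
  shows "\<alpha> = \<beta>"
  using assms by (auto simp: auto_def Bij_def intro: extensionalityI)

context group
begin

lemma AutoGroup_mult_closed [simp]:
  "\<lbrakk>\<alpha> \<in> auto G; \<beta> \<in> auto G\<rbrakk> \<Longrightarrow> \<alpha> \<otimes>\<^bsub>AutoGroup G\<^esub> \<beta> \<in> auto G"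
  using monoid.m_closed [OF group.is_monoid [OF AutoGroup]] by simp

lemma AutoGroup_inv_closed [simp]: "\<alpha> \<in> auto G \<Longrightarrow> inv\<^bsub>AutoGroup G\<^esub> \<alpha> \<in> auto G"
  using group.inv_closed [OF AutoGroup] by simp

lemma inv_cancel:
  assumes "g \<in> carrier G" "h \<in> carrier G"
  shows "inv g \<otimes> (g \<otimes> h) = h" "g \<otimes> (inv g \<otimes> h) = h"
  using assms by (simp_all flip: m_assoc)

lemma auto_one: "\<alpha> \<in> auto G \<Longrightarrow> \<alpha> \<one> = \<one>"
  by (metis Int_iff auto_def hom_one is_group)

lemma auto_inv: "\<lbrakk>\<alpha> \<in> auto G; g \<in> carrier G\<rbrakk> \<Longrightarrow> \<alpha> (inv g) = inv \<alpha> g"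
  by (metis auto_closed auto_mult auto_one inv_closed inv_equality l_inv)

lemma inner_aut_auto: "g \<in> carrier G \<Longrightarrow> inner_aut G g \<in> auto G"
proof -
  assume g: "g \<in> carrier G"
  have "inner_aut G g \<in> hom G G"
    using g by (auto simp: hom_def inner_aut_def m_assoc inv_cancel)
  moreover have "bij_betw (inner_aut G g) (carrier G) (carrier G)"
    by (rule bij_betw_byWitness[where f' = "\<lambda>h. inv g \<otimes> h \<otimes> g"])
       (use g in \<open>auto simp: inner_aut_def m_assoc inv_cancel\<close>)
  ultimately show ?thesis
    by (auto simp: auto_def Bij_def inner_aut_def)
qed

lemma inner_aut_one: "inner_aut G \<one> = \<one>\<^bsub>AutoGroup G\<^esub>"
  by (auto simp: inner_aut_def one_AutoGroup)

lemma inner_aut_mult: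
  assumes "g \<in> carrier G" "h \<in> carrier G"
  shows "inner_aut G g \<otimes>\<^bsub>AutoGroup G\<^esub> inner_aut G h = inner_aut G (g \<otimes> h)"
proof -
  have "compose (carrier G) (inner_aut G g) (inner_aut G h) = inner_aut G (g \<otimes> h)"
    using assms by (auto simp: compose_def inner_aut_def inv_mult_group m_assoc)
  then show ?thesis using assms by (simp add: mult_AutoGroup inner_aut_auto)
qed

lemma auto_inner_aut:
  assumes "\<alpha> \<in> auto G" "g \<in> carrier G"
  shows "\<alpha> \<otimes>\<^bsub>AutoGroup G\<^esub> inner_aut G g = inner_aut G (\<alpha> g) \<otimes>\<^bsub>AutoGroup G\<^esub> \<alpha>"
proof -
  have "compose (carrier G) \<alpha> (inner_aut G g) = compose (carrier G) (inner_aut G (\<alpha> g)) \<alpha>"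
    using assms
    by (auto simp: compose_def inner_aut_def auto_closed [OF assms(1)] auto_mult [OF assms(1)]
        auto_inv [OF assms(1)])
  then show ?thesis using assms by (simp add: mult_AutoGroup inner_aut_auto auto_closed)
qed

lemma Inn_normal: "Inn G \<lhd> AutoGroup G"
proof -
  interpret Au: group "AutoGroup G" by (rule AutoGroup)
  have inv: "inv\<^bsub>AutoGroup G\<^esub> inner_aut G g = inner_aut G (inv g)" if "g \<in> carrier G" for g
    by (rule Au.inv_equality)
       (use that in \<open>simp_all add: inner_aut_mult inner_aut_auto inner_aut_one\<close>)
  have sub: "subgroup (Inn G) (AutoGroup G)"
    by (rule Au.subgroupI)
       (auto simp: Inn_def inner_aut_auto inv inner_aut_mult)
  show ?thesis
  proof (rule Au.normal_invI [OF sub])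
    fix \<alpha> h assume \<alpha>: "\<alpha> \<in> carrier (AutoGroup G)" and "h \<in> Inn G"
    then obtain g where g: "g \<in> carrier G" "h = inner_aut G g" by (auto simp: Inn_def)
    have "\<alpha> \<otimes>\<^bsub>AutoGroup G\<^esub> h \<otimes>\<^bsub>AutoGroup G\<^esub> inv\<^bsub>AutoGroup G\<^esub> \<alpha> = inner_aut G (\<alpha> g)"
      using \<alpha> g by (simp add: auto_inner_aut Au.m_assoc inner_aut_auto auto_closed)
    then show "\<alpha> \<otimes>\<^bsub>AutoGroup G\<^esub> h \<otimes>\<^bsub>AutoGroup G\<^esub> inv\<^bsub>AutoGroup G\<^esub> \<alpha> \<in> Inn G"
      using \<alpha> g by (simp add: Inn_def auto_closed)
  qed
qed

lemma group_OutGroup: "group (OutGroup G)"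
  unfolding OutGroup_def by (rule normal.factorgroup_is_group [OF Inn_normal])

lemma subgroup_centre: "subgroup (centre G) G"
proof (rule subgroupI)
  show "centre G \<subseteq> carrier G" by (auto simp: centre_def)
  have "\<one> \<in> centre G" by (simp add: centre_def)
  then show "centre G \<noteq> {}" by blast
next
  fix a assume a: "a \<in> centre G"
  show "inv a \<in> centre G"
  proof (rule centreI)
    fix g assume g: "g \<in> carrier G"
    have "inv a \<otimes> g = inv (inv g \<otimes> a)"
      using g centre_closed [OF a] by (simp add: inv_mult_group)
    also have "inv g \<otimes> a = a \<otimes> inv g" using centre_comm [OF a] g by simp
    finally show "inv a \<otimes> g = g \<otimes> inv a"
      using g centre_closed [OF a] by (simp add: inv_mult_group)
  qed (use a in \<open>simp add: centre_closed\<close>)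
next
  fix a b assume ab: "a \<in> centre G" "b \<in> centre G"
  note [simp] = ab [THEN centre_closed]
  show "a \<otimes> b \<in> centre G"
  proof (rule centreI)
    fix g assume g: "g \<in> carrier G"
    have "a \<otimes> b \<otimes> g = a \<otimes> (g \<otimes> b)" using g by (simp add: centre_comm [OF ab(2) g] m_assoc)
    also have "\<dots> = g \<otimes> a \<otimes> b" using g by (simp add: centre_comm [OF ab(1) g] flip: m_assoc)
    finally show "a \<otimes> b \<otimes> g = g \<otimes> (a \<otimes> b)" using g by (simp add: m_assoc)
  qed simp
qed

lemma comm_group_centre: "comm_group (centre_group G)"
proof -
  interpret Z: group "centre_group G"
    by (rule subgroup.subgroup_is_group [OF subgroup_centre is_group])
  show ?thesis by (rule Z.group_comm_groupI) (simp add: centre_closed centre_comm)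
qed

lemma auto_centre: "\<lbrakk>\<alpha> \<in> auto G; c \<in> centre G\<rbrakk> \<Longrightarrow> \<alpha> c \<in> centre G"
proof -
  assume \<alpha>: "\<alpha> \<in> auto G" and c: "c \<in> centre G"
  have "\<alpha> c \<otimes> g = g \<otimes> \<alpha> c" if "g \<in> carrier G" for g
  proof -
    have "bij_betw \<alpha> (carrier G) (carrier G)" using \<alpha> by (auto simp: auto_def Bij_def)
    then obtain h where "h \<in> carrier G" "g = \<alpha> h" using \<open>g \<in> carrier G\<close> by (auto simp: bij_betw_def)
    then show ?thesis
      using centre_closed [OF c] centre_comm [OF c, of h] by (simp flip: auto_mult [OF \<alpha>])
  qed
  with \<alpha> c show ?thesis by (intro centreI) (simp_all add: auto_closed centre_closed)
qed

lemma inner_aut_eq_centre: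
  assumes "a \<in> carrier G" "b \<in> carrier G" "inner_aut G a = inner_aut G b"
  shows "a \<otimes> inv b \<in> centre G"
proof -
  have "a \<otimes> inv b \<otimes> g = g \<otimes> (a \<otimes> inv b)" if g: "g \<in> carrier G" for g
  proof -
    let ?h = "inv b \<otimes> g \<otimes> b"
    have "inner_aut G a ?h = inner_aut G b ?h" using assms by simp
    then have "a \<otimes> ?h \<otimes> inv a = g"
      using assms g by (simp add: inner_aut_def m_assoc inv_cancel)
    then have "a \<otimes> ?h \<otimes> inv a \<otimes> a \<otimes> inv b = g \<otimes> a \<otimes> inv b" by simp
    then show ?thesis using assms g by (simp add: m_assoc inv_cancel)
  qed
  then show ?thesis using assms by (intro centreI) simp_all
qed

end

context abstract_kernel
begin

lemma psi_coset: "x \<in> carrier P \<Longrightarrow> \<psi> x \<in> rcosets\<^bsub>AutoGroup G\<^esub> (Inn G)"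
  using psi_hom by (auto simp: hom_def OutGroup_def FactGroup_def)

lemma psi_auto: "\<lbrakk>x \<in> carrier P; \<alpha> \<in> \<psi> x\<rbrakk> \<Longrightarrow> \<alpha> \<in> auto G"
proof -
  interpret N: normal "Inn G" "AutoGroup G" by (rule G.Inn_normal)
  show "\<lbrakk>x \<in> carrier P; \<alpha> \<in> \<psi> x\<rbrakk> \<Longrightarrow> \<alpha> \<in> auto G"
    using N.rcosets_carrier [OF N.is_group psi_coset] by auto
qed

lemma psi_eq: "\<lbrakk>x \<in> carrier P; \<alpha> \<in> \<psi> x\<rbrakk> \<Longrightarrow> \<psi> x = Inn G #>\<^bsub>AutoGroup G\<^esub> \<alpha>"
proof -
  interpret N: normal "Inn G" "AutoGroup G" by (rule G.Inn_normal)
  assume x: "x \<in> carrier P" and \<alpha>: "\<alpha> \<in> \<psi> x"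
  obtain \<beta> where "\<beta> \<in> carrier (AutoGroup G)" "\<psi> x = Inn G #>\<^bsub>AutoGroup G\<^esub> \<beta>"
    using psi_coset [OF x] by (auto simp: RCOSETS_def)
  with \<alpha> show ?thesis using N.repr_independence N.subgroup_axioms by metis
qed

lemma psi_ne: "x \<in> carrier P \<Longrightarrow> \<exists>\<alpha>. \<alpha> \<in> \<psi> x"
proof -
  interpret N: normal "Inn G" "AutoGroup G" by (rule G.Inn_normal)
  show "x \<in> carrier P \<Longrightarrow> \<exists>\<alpha>. \<alpha> \<in> \<psi> x"
    using N.rcosets_non_empty [OF psi_coset] by auto
qed

lemma psi_cases:
  assumes "x \<in> carrier P" "\<alpha> \<in> \<psi> x" "\<beta> \<in> \<psi> x"
  obtains g where "g \<in> carrier G" "\<beta> = inner_aut G g \<otimes>\<^bsub>AutoGroup G\<^esub> \<alpha>"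
  using assms psi_eq [OF assms(1,2)] by (auto simp: r_coset_def Inn_def)

lemma psi_mult:
  assumes "x \<in> carrier P" "y \<in> carrier P" "\<alpha> \<in> \<psi> x" "\<beta> \<in> \<psi> y"
  shows "\<alpha> \<otimes>\<^bsub>AutoGroup G\<^esub> \<beta> \<in> \<psi> (x \<otimes>\<^bsub>P\<^esub> y)"
proof -
  have "\<psi> (x \<otimes>\<^bsub>P\<^esub> y) = \<psi> x <#>\<^bsub>AutoGroup G\<^esub> \<psi> y"
    using hom_mult [OF psi_hom] assms by (simp add: OutGroup_def)
  with assms show ?thesis by (auto simp: set_mult_def)
qed

lemma psi_one: "\<one>\<^bsub>AutoGroup G\<^esub> \<in> \<psi> \<one>\<^bsub>P\<^esub>"
proof -
  have "\<psi> \<one>\<^bsub>P\<^esub> = Inn G"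
    using hom_one [OF psi_hom P.is_group G.group_OutGroup] by (simp add: OutGroup_def)
  then show ?thesis by (auto simp: Inn_def simp flip: G.inner_aut_one)
qed

lemma centre_act_eq:
  assumes x: "x \<in> carrier P" and \<alpha>: "\<alpha> \<in> \<psi> x" and c: "c \<in> centre G"
  shows "centre_act \<psi> x c = \<alpha> c"
proof -
  let ?\<beta> = "SOME \<alpha>. \<alpha> \<in> \<psi> x"
  have \<beta>: "?\<beta> \<in> \<psi> x" using someI_ex [OF psi_ne [OF x]] .
  obtain g where g: "g \<in> carrier G" "?\<beta> = inner_aut G g \<otimes>\<^bsub>AutoGroup G\<^esub> \<alpha>"
    using psi_cases [OF x \<alpha> \<beta>] .
  have A: "\<alpha> \<in> auto G" using x \<alpha> by (rule psi_auto)
  have Z: "\<alpha> c \<in> centre G" using A c by (rule G.auto_centre)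
  have "?\<beta> c = g \<otimes>\<^bsub>G\<^esub> \<alpha> c \<otimes>\<^bsub>G\<^esub> inv\<^bsub>G\<^esub> g"
    using g A centre_closed [OF c]
    by (simp add: mult_AutoGroup G.inner_aut_auto compose_eq) (simp add: inner_aut_def auto_closed)
  also have "\<dots> = \<alpha> c \<otimes>\<^bsub>G\<^esub> g \<otimes>\<^bsub>G\<^esub> inv\<^bsub>G\<^esub> g"
    by (simp add: centre_comm [OF Z g(1)])
  also have "\<dots> = \<alpha> c" using g centre_closed [OF Z] by (simp add: G.m_assoc)
  finally show ?thesis by (simp add: centre_act_def)
qed

lemma group_module_centre: "group_module P (centre_group G) (centre_act \<psi>)"
proof -
  interpret Z: comm_group "centre_group G" by (rule G.comm_group_centre)
  have "group_semimodule P (centre_group G) (centre_act \<psi>)"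
  proof unfold_locales
    fix x a assume "x \<in> carrier P" "a \<in> carrier (centre_group G)"
    then show "centre_act \<psi> x a \<in> carrier (centre_group G)"
      using psi_ne psi_auto by (fastforce simp: centre_act_eq G.auto_centre)
  next
    fix x a b
    assume x: "x \<in> carrier P" and ab: "a \<in> carrier (centre_group G)" "b \<in> carrier (centre_group G)"
    obtain \<alpha> where \<alpha>: "\<alpha> \<in> \<psi> x" using psi_ne x by blast
    have "a \<otimes>\<^bsub>G\<^esub> b \<in> centre G" using Z.m_closed ab by simp
    with ab show "centre_act \<psi> x (a \<otimes>\<^bsub>centre_group G\<^esub> b)
        = centre_act \<psi> x a \<otimes>\<^bsub>centre_group G\<^esub> centre_act \<psi> x b"
      using psi_auto [OF x \<alpha>] by (simp add: centre_act_eq [OF x \<alpha>] auto_mult centre_closed)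
  next
    fix x assume x: "x \<in> carrier P"
    obtain \<alpha> where \<alpha>: "\<alpha> \<in> \<psi> x" using psi_ne x by blast
    have "\<one>\<^bsub>G\<^esub> \<in> centre G" using Z.one_closed by simp
    then show "centre_act \<psi> x \<one>\<^bsub>centre_group G\<^esub> = \<one>\<^bsub>centre_group G\<^esub>"
      using psi_auto [OF x \<alpha>] by (simp add: centre_act_eq [OF x \<alpha>] G.auto_one)
  next
    fix x y a assume x: "x \<in> carrier P" and y: "y \<in> carrier P" and a: "a \<in> carrier (centre_group G)"
    obtain \<alpha> \<beta> where \<alpha>: "\<alpha> \<in> \<psi> x" and \<beta>: "\<beta> \<in> \<psi> y" using psi_ne x y by blast
    show "centre_act \<psi> (x \<otimes>\<^bsub>P\<^esub> y) a = centre_act \<psi> x (centre_act \<psi> y a)"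
      using a psi_auto [OF x \<alpha>] psi_auto [OF y \<beta>] G.auto_centre [of \<beta> a]
        centre_act_eq [OF _ psi_mult [OF x y \<alpha> \<beta>], of a] x y
      by (simp add: centre_act_eq [OF x \<alpha>] centre_act_eq [OF y \<beta>] mult_AutoGroup compose_def centre_closed)
  next
    fix a assume "a \<in> carrier (centre_group G)"
    then show "centre_act \<psi> \<one>\<^bsub>P\<^esub> a = a"
      by (simp add: centre_act_eq [OF _ psi_one] one_AutoGroup centre_closed)
  qed
  then show ?thesis by (intro group_module.intro G.comm_group_centre)
qed

end


section \<open>Extensions\<close>

definition group_extension ::
    "('p, 'm) monoid_scheme \<Rightarrow> ('g, 'n) monoid_scheme \<Rightarrow> ('b, 'k) monoid_scheme
      \<Rightarrow> ('g \<Rightarrow> 'b) \<Rightarrow> ('b \<Rightarrow> 'p) \<Rightarrow> bool"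
  where "group_extension P G B i p \<longleftrightarrow>
    group P \<and> group G \<and> group B \<and> i \<in> mon G B \<and> p \<in> epi B P \<and>
    kernel B P p = i ` carrier G"

text \<open>Conjugation by \<open>b\<close> in \<open>B\<close>, transported to \<open>G\<close> along the injection \<open>i\<close>.\<close>

definition conj_aut ::
    "('g, 'n) monoid_scheme \<Rightarrow> ('b, 'k) monoid_scheme \<Rightarrow> ('g \<Rightarrow> 'b) \<Rightarrow> 'b \<Rightarrow> ('g \<Rightarrow> 'g)"
  where "conj_aut G B i b =
    (\<lambda>g\<in>carrier G. inv_into (carrier G) i (b \<otimes>\<^bsub>B\<^esub> i g \<otimes>\<^bsub>B\<^esub> inv\<^bsub>B\<^esub> b))"

text \<open>The homomorphism \<open>P \<rightarrow> OutGroup G\<close> induced by an extension sends \<open>p b\<close> to the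
  coset of \<open>conj_aut G B i b\<close>; as \<open>p\<close> is onto, this determines it on all of \<open>P\<close>.\<close>

definition extension_of_kernel ::
    "('p, 'm) monoid_scheme \<Rightarrow> ('g, 'n) monoid_scheme \<Rightarrow> ('p \<Rightarrow> ('g \<Rightarrow> 'g) set)
      \<Rightarrow> ('b, 'k) monoid_scheme \<Rightarrow> ('g \<Rightarrow> 'b) \<Rightarrow> ('b \<Rightarrow> 'p) \<Rightarrow> bool"
  where "extension_of_kernel P G \<psi> B i p \<longleftrightarrow>
    group_extension P G B i p \<and>
    (\<forall>b\<in>carrier B. \<psi> (p b) = Inn G #>\<^bsub>AutoGroup G\<^esub> conj_aut G B i b)"

text \<open>A choice of representatives of the fibres of \<open>p\<close> identifies the underlying set of
  any extension with \<open>carrier G \<times> carrier P\<close>, so fixing the element type of \<open>B\<close> loses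
  no extension up to isomorphism.\<close>

definition has_extension ::
    "('p, 'm) monoid_scheme \<Rightarrow> ('g, 'n) monoid_scheme \<Rightarrow> ('p \<Rightarrow> ('g \<Rightarrow> 'g) set) \<Rightarrow> bool"
  where "has_extension P G \<psi> \<longleftrightarrow>
    (\<exists>(B :: ('g \<times> 'p) monoid) i p. extension_of_kernel P G \<psi> B i p)"


section \<open>The obstruction class\<close>

text \<open>\<open>k\<close> is the cocycle determined by the choice of \<open>\<phi>\<close> and \<open>f\<close>
  (see \<open>obstruction_cocycle_unique_exists\<close> below).\<close>

definition obstruction_cocycle ::
    "('p, 'm) monoid_scheme \<Rightarrow> ('g, 'n) monoid_scheme \<Rightarrow> ('p \<Rightarrow> ('g \<Rightarrow> 'g) set)
      \<Rightarrow> ('p \<Rightarrow> 'g \<Rightarrow> 'g) \<Rightarrow> ('p \<times> 'p \<Rightarrow> 'g) \<Rightarrow> ('p \<times> 'p \<times> 'p \<Rightarrow> 'g) \<Rightarrow> bool"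
  where "obstruction_cocycle P G \<psi> \<phi> f k \<longleftrightarrow>
    (\<forall>x\<in>carrier P. \<phi> x \<in> \<psi> x) \<and>
    \<phi> \<one>\<^bsub>P\<^esub> = \<one>\<^bsub>AutoGroup G\<^esub> \<and>
    f \<in> cochains2 P G \<and>
    (\<forall>x\<in>carrier P. \<forall>y\<in>carrier P.
      \<phi> x \<otimes>\<^bsub>AutoGroup G\<^esub> \<phi> y
        = inner_aut G (f (x, y)) \<otimes>\<^bsub>AutoGroup G\<^esub> \<phi> (x \<otimes>\<^bsub>P\<^esub> y)) \<and>
    k \<in> cocycles3 P (centre_group G) (centre_act \<psi>) \<and>
    (\<forall>x\<in>carrier P. \<forall>y\<in>carrier P. \<forall>z\<in>carrier P.
      \<phi> x (f (y, z)) \<otimes>\<^bsub>G\<^esub> f (x, y \<otimes>\<^bsub>P\<^esub> z)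
        = k (x, y, z) \<otimes>\<^bsub>G\<^esub> f (x, y) \<otimes>\<^bsub>G\<^esub> f (x \<otimes>\<^bsub>P\<^esub> y, z))"

text \<open>The class of the cocycle of one choice of \<open>\<phi>\<close> and \<open>f\<close>; by Eilenberg and Mac Lane
  every other choice gives the same class.\<close>

definition Obs ::
    "('p, 'm) monoid_scheme \<Rightarrow> ('g, 'n) monoid_scheme \<Rightarrow> ('p \<Rightarrow> ('g \<Rightarrow> 'g) set)
      \<Rightarrow> ('p \<times> 'p \<times> 'p \<Rightarrow> 'g) set"
  where "Obs P G \<psi> = cohomologous3 P (centre_group G) (centre_act \<psi>) ``
    {SOME k. \<exists>\<phi> f. obstruction_cocycle P G \<psi> \<phi> f k}"

context abstract_kernel
begin

text \<open>The choices made in the definition of the obstruction class are possible, and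
  every admissible \<open>\<phi>\<close>, \<open>f\<close> determine a cocycle.\<close>

lemma obstruction_data_exists:
  "\<exists>\<phi> f. (\<forall>x\<in>carrier P. \<phi> x \<in> \<psi> x) \<and> \<phi> \<one>\<^bsub>P\<^esub> = \<one>\<^bsub>AutoGroup G\<^esub> \<and> f \<in> cochains2 P G \<and>
    (\<forall>x\<in>carrier P. \<forall>y\<in>carrier P.
      \<phi> x \<otimes>\<^bsub>AutoGroup G\<^esub> \<phi> y
        = inner_aut G (f (x, y)) \<otimes>\<^bsub>AutoGroup G\<^esub> \<phi> (x \<otimes>\<^bsub>P\<^esub> y))"
proof -
  interpret Au: group "AutoGroup G" by (rule G.AutoGroup)
  define \<phi> where "\<phi> x = (if x = \<one>\<^bsub>P\<^esub> then \<one>\<^bsub>AutoGroup G\<^esub> else SOME \<alpha>. \<alpha> \<in> \<psi> x)" for x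
  have \<phi>: "\<phi> x \<in> \<psi> x" if "x \<in> carrier P" for x
    using psi_one someI_ex [OF psi_ne [OF that]] by (simp add: \<phi>_def)
  have \<phi>a: "\<phi> x \<in> auto G" if "x \<in> carrier P" for x
    using psi_auto [OF that \<phi> [OF that]] .
  define f where "f = (\<lambda>(x, y)\<in>carrier P \<times> carrier P.
    if x = \<one>\<^bsub>P\<^esub> \<or> y = \<one>\<^bsub>P\<^esub> then \<one>\<^bsub>G\<^esub> else SOME g. g \<in> carrier G \<and>
      \<phi> x \<otimes>\<^bsub>AutoGroup G\<^esub> \<phi> y = inner_aut G g \<otimes>\<^bsub>AutoGroup G\<^esub> \<phi> (x \<otimes>\<^bsub>P\<^esub> y))"
  have f: "f (x, y) \<in> carrier G \<and>
      \<phi> x \<otimes>\<^bsub>AutoGroup G\<^esub> \<phi> y = inner_aut G (f (x, y)) \<otimes>\<^bsub>AutoGroup G\<^esub> \<phi> (x \<otimes>\<^bsub>P\<^esub> y)"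
    if "x \<in> carrier P" "y \<in> carrier P" for x y
  proof (cases "x = \<one>\<^bsub>P\<^esub> \<or> y = \<one>\<^bsub>P\<^esub>")
    case True
    then show ?thesis
      using that \<phi>a [of x] \<phi>a [of y]
      by (auto simp: f_def G.inner_aut_one) (auto simp: \<phi>_def)
  next
    case False
    have "\<exists>g. g \<in> carrier G \<and>
      \<phi> x \<otimes>\<^bsub>AutoGroup G\<^esub> \<phi> y = inner_aut G g \<otimes>\<^bsub>AutoGroup G\<^esub> \<phi> (x \<otimes>\<^bsub>P\<^esub> y)"
      using psi_cases [OF P.m_closed [OF that] \<phi> [OF P.m_closed [OF that]]
          psi_mult [OF that \<phi> [OF that(1)] \<phi> [OF that(2)]]] by metis
    from someI_ex [OF this] False that show ?thesis by (simp add: f_def)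
  qed
  have "f \<in> cochains2 P G"
    using f by (auto simp: cochains2_def PiE_def extensional_def) (auto simp: f_def)
  moreover have "\<phi> \<one>\<^bsub>P\<^esub> = \<one>\<^bsub>AutoGroup G\<^esub>" by (simp add: \<phi>_def)
  ultimately show ?thesis using \<phi> f by blast
qed

lemma obstruction_cocycle_unique_exists:
  assumes \<phi>: "\<forall>x\<in>carrier P. \<phi> x \<in> \<psi> x" and \<phi>1: "\<phi> \<one>\<^bsub>P\<^esub> = \<one>\<^bsub>AutoGroup G\<^esub>"
    and f: "f \<in> cochains2 P G"
    and \<phi>f: "\<forall>x\<in>carrier P. \<forall>y\<in>carrier P.
      \<phi> x \<otimes>\<^bsub>AutoGroup G\<^esub> \<phi> y
        = inner_aut G (f (x, y)) \<otimes>\<^bsub>AutoGroup G\<^esub> \<phi> (x \<otimes>\<^bsub>P\<^esub> y)"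
  shows "\<exists>!k. obstruction_cocycle P G \<psi> \<phi> f k"
proof -
  interpret Au: group "AutoGroup G" by (rule G.AutoGroup)
  have a: "\<phi> x \<in> auto G" if "x \<in> carrier P" for x
    using psi_auto that \<phi> by blast
  have F: "f (x, y) \<in> carrier G" if "x \<in> carrier P" "y \<in> carrier P" for x y
    using f that by (auto simp: cochains2_def)
  have F1: "f (x, \<one>\<^bsub>P\<^esub>) = \<one>\<^bsub>G\<^esub>" "f (\<one>\<^bsub>P\<^esub>, x) = \<one>\<^bsub>G\<^esub>" if "x \<in> carrier P" for x
    using f that by (auto simp: cochains2_def)
  have M: "\<phi> x (g \<otimes>\<^bsub>G\<^esub> h) = \<phi> x g \<otimes>\<^bsub>G\<^esub> \<phi> x h"
    if "x \<in> carrier P" "g \<in> carrier G" "h \<in> carrier G" for x g h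
    using auto_mult a that by metis
  have cl: "\<phi> x g \<in> carrier G" if "x \<in> carrier P" "g \<in> carrier G" for x g
    using auto_closed a that by metis
  have \<phi>\<phi>: "\<phi> x (\<phi> y g) = f (x, y) \<otimes>\<^bsub>G\<^esub> \<phi> (x \<otimes>\<^bsub>P\<^esub> y) g \<otimes>\<^bsub>G\<^esub> inv\<^bsub>G\<^esub> f (x, y)"
    if "x \<in> carrier P" "y \<in> carrier P" "g \<in> carrier G" for x y g
  proof -
    have "(\<phi> x \<otimes>\<^bsub>AutoGroup G\<^esub> \<phi> y) g
        = (inner_aut G (f (x, y)) \<otimes>\<^bsub>AutoGroup G\<^esub> \<phi> (x \<otimes>\<^bsub>P\<^esub> y)) g"
      using \<phi>f that by simp
    then show ?thesis
      using that
      by (simp add: mult_AutoGroup a G.inner_aut_auto F compose_eq cl) (simp add: inner_aut_def cl)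
  qed
  define k where "k = (\<lambda>(x, y, z)\<in>carrier P \<times> carrier P \<times> carrier P.
    \<phi> x (f (y, z)) \<otimes>\<^bsub>G\<^esub> f (x, y \<otimes>\<^bsub>P\<^esub> z)
      \<otimes>\<^bsub>G\<^esub> inv\<^bsub>G\<^esub> (f (x, y) \<otimes>\<^bsub>G\<^esub> f (x \<otimes>\<^bsub>P\<^esub> y, z)))"
  have kZ: "k (x, y, z) \<in> centre G"
    if x: "x \<in> carrier P" and y: "y \<in> carrier P" and z: "z \<in> carrier P" for x y z
  proof -
    note c = x y z a F cl G.inner_aut_auto
    let ?a = "\<phi> x (f (y, z)) \<otimes>\<^bsub>G\<^esub> f (x, y \<otimes>\<^bsub>P\<^esub> z)"
    let ?b = "f (x, y) \<otimes>\<^bsub>G\<^esub> f (x \<otimes>\<^bsub>P\<^esub> y, z)"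
    have "inner_aut G ?a \<otimes>\<^bsub>AutoGroup G\<^esub> \<phi> (x \<otimes>\<^bsub>P\<^esub> y \<otimes>\<^bsub>P\<^esub> z)
        = inner_aut G (\<phi> x (f (y, z))) \<otimes>\<^bsub>AutoGroup G\<^esub> (\<phi> x \<otimes>\<^bsub>AutoGroup G\<^esub> \<phi> (y \<otimes>\<^bsub>P\<^esub> z))"
      using \<phi>f by (simp add: c P.m_assoc Au.m_assoc flip: G.inner_aut_mult)
    also have "\<dots> = \<phi> x \<otimes>\<^bsub>AutoGroup G\<^esub> inner_aut G (f (y, z)) \<otimes>\<^bsub>AutoGroup G\<^esub> \<phi> (y \<otimes>\<^bsub>P\<^esub> z)"
      by (simp add: c G.auto_inner_aut Au.m_assoc)
    also have "\<dots> = \<phi> x \<otimes>\<^bsub>AutoGroup G\<^esub> (\<phi> y \<otimes>\<^bsub>AutoGroup G\<^esub> \<phi> z)"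
      using \<phi>f by (simp add: c Au.m_assoc)
    also have "\<dots> = \<phi> x \<otimes>\<^bsub>AutoGroup G\<^esub> \<phi> y \<otimes>\<^bsub>AutoGroup G\<^esub> \<phi> z"
      by (simp add: c Au.m_assoc)
    also have "\<phi> x \<otimes>\<^bsub>AutoGroup G\<^esub> \<phi> y
        = inner_aut G (f (x, y)) \<otimes>\<^bsub>AutoGroup G\<^esub> \<phi> (x \<otimes>\<^bsub>P\<^esub> y)"
      using \<phi>f x y by simp
    also have "inner_aut G (f (x, y)) \<otimes>\<^bsub>AutoGroup G\<^esub> \<phi> (x \<otimes>\<^bsub>P\<^esub> y) \<otimes>\<^bsub>AutoGroup G\<^esub> \<phi> z
        = inner_aut G (f (x, y)) \<otimes>\<^bsub>AutoGroup G\<^esub> (\<phi> (x \<otimes>\<^bsub>P\<^esub> y) \<otimes>\<^bsub>AutoGroup G\<^esub> \<phi> z)"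
      by (simp add: c Au.m_assoc)
    also have "\<dots> = inner_aut G ?b \<otimes>\<^bsub>AutoGroup G\<^esub> \<phi> (x \<otimes>\<^bsub>P\<^esub> y \<otimes>\<^bsub>P\<^esub> z)"
      using \<phi>f by (simp add: c Au.m_assoc flip: G.inner_aut_mult)
    finally have "inner_aut G ?a = inner_aut G ?b" by (simp add: c)
    then show ?thesis using G.inner_aut_eq_centre [of ?a ?b] by (simp add: k_def c)
  qed
  have kG: "k (x, y, z) \<in> carrier G"
    if "x \<in> carrier P" "y \<in> carrier P" "z \<in> carrier P" for x y z
    using kZ [OF that] by (rule centre_closed)
  have comm: "g \<otimes>\<^bsub>G\<^esub> k (x, y, z) = k (x, y, z) \<otimes>\<^bsub>G\<^esub> g"
    if "x \<in> carrier P" "y \<in> carrier P" "z \<in> carrier P" "g \<in> carrier G" for x y z g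
    using centre_comm [OF kZ [OF that(1-3)] that(4)] by simp
  have E: "\<phi> x (f (y, z)) \<otimes>\<^bsub>G\<^esub> f (x, y \<otimes>\<^bsub>P\<^esub> z)
        = k (x, y, z) \<otimes>\<^bsub>G\<^esub> (f (x, y) \<otimes>\<^bsub>G\<^esub> f (x \<otimes>\<^bsub>P\<^esub> y, z))"
    if "x \<in> carrier P" "y \<in> carrier P" "z \<in> carrier P" for x y z
    using that by (simp add: k_def F cl G.m_assoc)
  have coc: "\<phi> x (k (y, z, t)) \<otimes>\<^bsub>G\<^esub> k (x, y \<otimes>\<^bsub>P\<^esub> z, t) \<otimes>\<^bsub>G\<^esub> k (x, y, z)
      = k (x \<otimes>\<^bsub>P\<^esub> y, z, t) \<otimes>\<^bsub>G\<^esub> k (x, y, z \<otimes>\<^bsub>P\<^esub> t)"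
    if x: "x \<in> carrier P" and y: "y \<in> carrier P" and z: "z \<in> carrier P" and t: "t \<in> carrier P"
    for x y z t
  proof -
    note c = x y z t a F cl kG
    let ?w = "f (x, y) \<otimes>\<^bsub>G\<^esub> f (x \<otimes>\<^bsub>P\<^esub> y, z) \<otimes>\<^bsub>G\<^esub> f (x \<otimes>\<^bsub>P\<^esub> y \<otimes>\<^bsub>P\<^esub> z, t)"
    let ?J = "\<phi> x (\<phi> y (f (z, t)) \<otimes>\<^bsub>G\<^esub> f (y, z \<otimes>\<^bsub>P\<^esub> t)) \<otimes>\<^bsub>G\<^esub> f (x, y \<otimes>\<^bsub>P\<^esub> (z \<otimes>\<^bsub>P\<^esub> t))"
    have "?J = \<phi> x (k (y, z, t)) \<otimes>\<^bsub>G\<^esub> (\<phi> x (f (y, z))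
        \<otimes>\<^bsub>G\<^esub> (\<phi> x (f (y \<otimes>\<^bsub>P\<^esub> z, t)) \<otimes>\<^bsub>G\<^esub> f (x, (y \<otimes>\<^bsub>P\<^esub> z) \<otimes>\<^bsub>P\<^esub> t)))"
      unfolding E [OF y z t] by (simp add: c M G.m_assoc P.m_assoc)
    also have "\<dots> = \<phi> x (k (y, z, t)) \<otimes>\<^bsub>G\<^esub> ((\<phi> x (f (y, z)) \<otimes>\<^bsub>G\<^esub> k (x, y \<otimes>\<^bsub>P\<^esub> z, t))
        \<otimes>\<^bsub>G\<^esub> (f (x, y \<otimes>\<^bsub>P\<^esub> z) \<otimes>\<^bsub>G\<^esub> f (x \<otimes>\<^bsub>P\<^esub> (y \<otimes>\<^bsub>P\<^esub> z), t)))"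
      unfolding E [OF x P.m_closed [OF y z] t] by (simp add: c G.m_assoc)
    also have "\<dots> = \<phi> x (k (y, z, t)) \<otimes>\<^bsub>G\<^esub> (k (x, y \<otimes>\<^bsub>P\<^esub> z, t)
        \<otimes>\<^bsub>G\<^esub> ((\<phi> x (f (y, z)) \<otimes>\<^bsub>G\<^esub> f (x, y \<otimes>\<^bsub>P\<^esub> z)) \<otimes>\<^bsub>G\<^esub> f (x \<otimes>\<^bsub>P\<^esub> (y \<otimes>\<^bsub>P\<^esub> z), t)))"
      unfolding comm [OF x P.m_closed [OF y z] t cl [OF x F [OF y z]]]
      by (simp add: c G.m_assoc)
    also have "\<dots> = \<phi> x (k (y, z, t)) \<otimes>\<^bsub>G\<^esub> k (x, y \<otimes>\<^bsub>P\<^esub> z, t) \<otimes>\<^bsub>G\<^esub> k (x, y, z) \<otimes>\<^bsub>G\<^esub> ?w"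
      unfolding E [OF x y z] by (simp add: c G.m_assoc P.m_assoc)
    finally have 1: "?J = \<dots>" .
    have "?J = \<phi> x (\<phi> y (f (z, t)))
        \<otimes>\<^bsub>G\<^esub> (\<phi> x (f (y, z \<otimes>\<^bsub>P\<^esub> t)) \<otimes>\<^bsub>G\<^esub> f (x, y \<otimes>\<^bsub>P\<^esub> (z \<otimes>\<^bsub>P\<^esub> t)))"
      by (simp add: c M G.m_assoc)
    also have "\<dots> = (\<phi> x (\<phi> y (f (z, t))) \<otimes>\<^bsub>G\<^esub> k (x, y, z \<otimes>\<^bsub>P\<^esub> t))
        \<otimes>\<^bsub>G\<^esub> (f (x, y) \<otimes>\<^bsub>G\<^esub> f (x \<otimes>\<^bsub>P\<^esub> y, z \<otimes>\<^bsub>P\<^esub> t))"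
      unfolding E [OF x y P.m_closed [OF z t]] by (simp add: c G.m_assoc)
    also have "\<dots> = k (x, y, z \<otimes>\<^bsub>P\<^esub> t) \<otimes>\<^bsub>G\<^esub> (\<phi> x (\<phi> y (f (z, t)))
        \<otimes>\<^bsub>G\<^esub> (f (x, y) \<otimes>\<^bsub>G\<^esub> f (x \<otimes>\<^bsub>P\<^esub> y, z \<otimes>\<^bsub>P\<^esub> t)))"
      unfolding comm [OF x y P.m_closed [OF z t] cl [OF x cl [OF y F [OF z t]]]]
      by (simp add: c G.m_assoc)
    also have "\<dots> = k (x, y, z \<otimes>\<^bsub>P\<^esub> t) \<otimes>\<^bsub>G\<^esub> (f (x, y)
        \<otimes>\<^bsub>G\<^esub> (\<phi> (x \<otimes>\<^bsub>P\<^esub> y) (f (z, t)) \<otimes>\<^bsub>G\<^esub> f (x \<otimes>\<^bsub>P\<^esub> y, z \<otimes>\<^bsub>P\<^esub> t)))"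
      unfolding \<phi>\<phi> [OF x y F [OF z t]]
      by (simp add: c G.m_assoc G.inv_cancel)
    also have "\<dots> = k (x, y, z \<otimes>\<^bsub>P\<^esub> t) \<otimes>\<^bsub>G\<^esub> ((f (x, y) \<otimes>\<^bsub>G\<^esub> k (x \<otimes>\<^bsub>P\<^esub> y, z, t))
        \<otimes>\<^bsub>G\<^esub> (f (x \<otimes>\<^bsub>P\<^esub> y, z) \<otimes>\<^bsub>G\<^esub> f (x \<otimes>\<^bsub>P\<^esub> y \<otimes>\<^bsub>P\<^esub> z, t)))"
      unfolding E [OF P.m_closed [OF x y] z t] by (simp add: c G.m_assoc)
    also have "\<dots> = k (x, y, z \<otimes>\<^bsub>P\<^esub> t) \<otimes>\<^bsub>G\<^esub> k (x \<otimes>\<^bsub>P\<^esub> y, z, t) \<otimes>\<^bsub>G\<^esub> ?w"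
      unfolding comm [OF P.m_closed [OF x y] z t F [OF x y]] by (simp add: c G.m_assoc)
    also have "\<dots> = k (x \<otimes>\<^bsub>P\<^esub> y, z, t) \<otimes>\<^bsub>G\<^esub> k (x, y, z \<otimes>\<^bsub>P\<^esub> t) \<otimes>\<^bsub>G\<^esub> ?w"
      using comm [OF x y P.m_closed [OF z t] kG [OF P.m_closed [OF x y] z t]] by simp
    finally show ?thesis using 1 by (simp add: c)
  qed
  have "k \<in> cochains3 P (centre_group G)"
    using kZ
    by (auto simp: cochains3_def PiE_def extensional_def)
       (auto simp: k_def F1 F \<phi>1 one_AutoGroup a G.auto_one cl G.m_assoc)
  then have "k \<in> cocycles3 P (centre_group G) (centre_act \<psi>)"
    using coc \<phi> kZ by (simp add: cocycles3_def centre_act_eq [OF _ bspec [OF \<phi>]])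
  then have ex: "obstruction_cocycle P G \<psi> \<phi> f k"
    using assms E by (simp add: obstruction_cocycle_def G.m_assoc kG F)
  show ?thesis
  proof (rule ex1I, rule ex)
    fix k' assume k': "obstruction_cocycle P G \<psi> \<phi> f k'"
    then have c': "k' \<in> cochains3 P (centre_group G)"
      by (auto simp: obstruction_cocycle_def cocycles3_def)
    show "k' = k"
    proof
      fix u
      show "k' u = k u"
      proof (cases "u \<in> carrier P \<times> carrier P \<times> carrier P")
        case True
        then obtain x y z where u: "u = (x, y, z)"
          and x: "x \<in> carrier P" and y: "y \<in> carrier P" and z: "z \<in> carrier P" by auto
        have k'G: "k' u \<in> carrier G" using c' True by (auto simp: cochains3_def intro: centre_closed)
        have "k' (x, y, z) \<otimes>\<^bsub>G\<^esub> (f (x, y) \<otimes>\<^bsub>G\<^esub> f (x \<otimes>\<^bsub>P\<^esub> y, z))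
            = k (x, y, z) \<otimes>\<^bsub>G\<^esub> (f (x, y) \<otimes>\<^bsub>G\<^esub> f (x \<otimes>\<^bsub>P\<^esub> y, z))"
          using k' E [OF x y z] k'G x y z u by (simp add: obstruction_cocycle_def G.m_assoc F)
        then show ?thesis using k'G kG x y z u by (simp add: F)
      next
        case False
        then show ?thesis
          using c' by (cases u) (auto simp: cochains3_def PiE_def extensional_def k_def)
      qed
    qed
  qed
qed

lemma Obs_in_H3: "Obs P G \<psi> \<in> carrier (H3 P (centre_group G) (centre_act \<psi>))"
proof -
  obtain \<phi> f k where "obstruction_cocycle P G \<psi> \<phi> f k"
    using obstruction_data_exists obstruction_cocycle_unique_exists by metis
  then have "\<exists>k \<phi> f. obstruction_cocycle P G \<psi> \<phi> f k" by blast
  from someI_ex [OF this]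
  have "(SOME k. \<exists>\<phi> f. obstruction_cocycle P G \<psi> \<phi> f k)
      \<in> cocycles3 P (centre_group G) (centre_act \<psi>)"
    by (auto simp: obstruction_cocycle_def)
  then show ?thesis by (simp add: Obs_def H3_def quotientI)
qed

end

end

theory Submission
  imports Defs
begin

text \<open>
  The argument rests on two facts. A homomorphism of semimodules carries cohomologous
  cocycles to cohomologous cocycles (\<open>cohomologous3_image\<close>), and an abstract kernel with
  one obstruction cocycle cohomologous to the trivial one has an extension, which is
  half of the theorem of Eilenberg and Mac Lane
  (\<open>extension_if_obstruction_trivial\<close>).

  Let \<open>f\<close> be the cocycle with values in \<open>A\<close> whose image under \<open>j\<close> lies in the obstruction
  class. The vanishing of the cohomology monoid of \<open>A\<close> gives cochains \<open>g1\<close>, \<open>g2\<close> with values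
  in \<open>A\<close> that identify \<open>f\<close> with the trivial cocycle. Their images under \<open>j\<close> do the same for
  \<open>j \<circ> f\<close> over the centre of \<open>G\<close>. The centre is a group, so there the identification is the
  ordinary relation of differing by a coboundary. Hence the obstruction class is trivial.

  For the fact about extensions, let \<open>\<phi>\<close> and \<open>h\<close> be the choices that define an obstruction
  cocycle, and let \<open>g\<close> be a cochain with central values that exhibits this cocycle as a
  coboundary. Multiplying \<open>h\<close> by \<open>g\<close> does not affect conjugation by the elements
  \<open>h (x, y)\<close>, but it removes the cocycle from the obstruction identity and leaves the condition
  for a nonabelian factor set. This condition is what makes the Schreier product
  \<open>(a, x) (b, y) = (a \<cdot> \<phi> x b \<cdot> h (x, y), x y)\<close> on \<open>G \<times> P\<close> associative.
\<close>

section \<open>Functoriality of cohomology\<close>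

lemma cochains2_image:
  assumes j: "j \<in> carrier A \<rightarrow> carrier D" "j \<one>\<^bsub>A\<^esub> = \<one>\<^bsub>D\<^esub>"
    and g: "g \<in> cochains2 P A" and P: "monoid P"
  shows "(\<lambda>t\<in>carrier P \<times> carrier P. j (g t)) \<in> cochains2 P D"
  using g j monoid.one_closed [OF P] by (auto simp: cochains2_def PiE_def Pi_def)

lemma cocycles3_image:
  assumes A: "group_semimodule P A act"
    and j: "j \<in> hom A D" "j \<one>\<^bsub>A\<^esub> = \<one>\<^bsub>D\<^esub>"
    and eq: "\<And>x a. \<lbrakk>x \<in> carrier P; a \<in> carrier A\<rbrakk> \<Longrightarrow> j (act x a) = act' x (j a)"
    and f: "f \<in> cocycles3 P A act"
  shows "(\<lambda>t\<in>carrier P \<times> carrier P \<times> carrier P. j (f t)) \<in> cocycles3 P D act'"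
proof -
  interpret group_semimodule P A act by (rule A)
  have f3: "f (x, y, z) \<in> carrier A"
    if "x \<in> carrier P" "y \<in> carrier P" "z \<in> carrier P" for x y z
    using f that by (auto simp: cocycles3_def cochains3_def)
  have jf: "j (f (x, y, z)) \<in> carrier D"
    if "x \<in> carrier P" "y \<in> carrier P" "z \<in> carrier P" for x y z
    using f3 [OF that] hom_in_carrier j(1) by metis
  have "act' x1 (j (f (x2, x3, x4))) \<otimes>\<^bsub>D\<^esub> j (f (x1, x2 \<otimes>\<^bsub>P\<^esub> x3, x4)) \<otimes>\<^bsub>D\<^esub> j (f (x1, x2, x3))
      = j (f (x1 \<otimes>\<^bsub>P\<^esub> x2, x3, x4)) \<otimes>\<^bsub>D\<^esub> j (f (x1, x2, x3 \<otimes>\<^bsub>P\<^esub> x4))"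
    if x: "x1 \<in> carrier P" "x2 \<in> carrier P" "x3 \<in> carrier P" "x4 \<in> carrier P"
    for x1 x2 x3 x4
  proof -
    have "j (act x1 (f (x2, x3, x4)) \<otimes>\<^bsub>A\<^esub> f (x1, x2 \<otimes>\<^bsub>P\<^esub> x3, x4) \<otimes>\<^bsub>A\<^esub> f (x1, x2, x3))
        = j (f (x1 \<otimes>\<^bsub>P\<^esub> x2, x3, x4) \<otimes>\<^bsub>A\<^esub> f (x1, x2, x3 \<otimes>\<^bsub>P\<^esub> x4))"
      using f x by (simp add: cocycles3_def)
    then show ?thesis using x by (simp add: hom_mult [OF j(1)] f3 act_closed eq)
  qed
  moreover have "(\<lambda>t\<in>carrier P \<times> carrier P \<times> carrier P. j (f t)) \<in> cochains3 P D"
    using f jf by (auto simp: cocycles3_def cochains3_def j(2))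
  ultimately show ?thesis by (simp add: cocycles3_def)
qed

text \<open>The relation between cocycles contains no inverses, so a homomorphism carries the two
  cochains witnessing it to cochains witnessing it for the images.\<close>

lemma cohomologous3_image:
  assumes A: "group_semimodule P A act"
    and j: "j \<in> hom A D" "j \<one>\<^bsub>A\<^esub> = \<one>\<^bsub>D\<^esub>"
    and eq: "\<And>x a. \<lbrakk>x \<in> carrier P; a \<in> carrier A\<rbrakk> \<Longrightarrow> j (act x a) = act' x (j a)"
    and ff': "(f, f') \<in> cohomologous3 P A act"
  shows "(\<lambda>t\<in>carrier P \<times> carrier P \<times> carrier P. j (f t),
      \<lambda>t\<in>carrier P \<times> carrier P \<times> carrier P. j (f' t)) \<in> cohomologous3 P D act'"
proof -
  interpret group_semimodule P A act by (rule A)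
  obtain g1 g2 where f: "f \<in> cocycles3 P A act" "f' \<in> cocycles3 P A act"
    and g: "g1 \<in> cochains2 P A" "g2 \<in> cochains2 P A"
    and e: "\<And>x y z. x \<in> carrier P \<Longrightarrow> y \<in> carrier P \<Longrightarrow> z \<in> carrier P \<Longrightarrow>
        f (x, y, z) \<otimes>\<^bsub>A\<^esub> g1 (x \<otimes>\<^bsub>P\<^esub> y, z) \<otimes>\<^bsub>A\<^esub> g1 (x, y)
          \<otimes>\<^bsub>A\<^esub> act x (g2 (y, z)) \<otimes>\<^bsub>A\<^esub> g2 (x, y \<otimes>\<^bsub>P\<^esub> z)
        = f' (x, y, z) \<otimes>\<^bsub>A\<^esub> g2 (x \<otimes>\<^bsub>P\<^esub> y, z) \<otimes>\<^bsub>A\<^esub> g2 (x, y)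
          \<otimes>\<^bsub>A\<^esub> act x (g1 (y, z)) \<otimes>\<^bsub>A\<^esub> g1 (x, y \<otimes>\<^bsub>P\<^esub> z)"
    using ff' by (auto simp: cohomologous3_def)
  have c2: "g (x, y) \<in> carrier A"
    if "g \<in> cochains2 P A" "x \<in> carrier P" "y \<in> carrier P" for g x y
    using that by (auto simp: cochains2_def)
  have c3: "g (x, y, z) \<in> carrier A"
    if "g \<in> cocycles3 P A act" "x \<in> carrier P" "y \<in> carrier P" "z \<in> carrier P" for g x y z
    using that by (auto simp: cocycles3_def cochains3_def)
  define h1 where "h1 = (\<lambda>t\<in>carrier P \<times> carrier P. j (g1 t))"
  define h2 where "h2 = (\<lambda>t\<in>carrier P \<times> carrier P. j (g2 t))"
  define k where "k = (\<lambda>t\<in>carrier P \<times> carrier P \<times> carrier P. j (f t))"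
  define k' where "k' = (\<lambda>t\<in>carrier P \<times> carrier P \<times> carrier P. j (f' t))"
  have "j \<in> carrier A \<rightarrow> carrier D" using j(1) by (simp add: hom_def)
  then have h: "h1 \<in> cochains2 P D" "h2 \<in> cochains2 P D"
    unfolding h1_def h2_def using g j(2) P.is_monoid by (simp_all add: cochains2_image)
  have k: "k \<in> cocycles3 P D act'" "k' \<in> cocycles3 P D act'"
    unfolding k_def k'_def
    by (rule cocycles3_image [where j = j and act' = act', OF A j _ f(1)], erule (1) eq)
       (rule cocycles3_image [where j = j and act' = act', OF A j _ f(2)], erule (1) eq)
  have "\<forall>x\<in>carrier P. \<forall>y\<in>carrier P. \<forall>z\<in>carrier P.
      k (x, y, z) \<otimes>\<^bsub>D\<^esub> h1 (x \<otimes>\<^bsub>P\<^esub> y, z) \<otimes>\<^bsub>D\<^esub> h1 (x, y)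
        \<otimes>\<^bsub>D\<^esub> act' x (h2 (y, z)) \<otimes>\<^bsub>D\<^esub> h2 (x, y \<otimes>\<^bsub>P\<^esub> z)
      = k' (x, y, z) \<otimes>\<^bsub>D\<^esub> h2 (x \<otimes>\<^bsub>P\<^esub> y, z) \<otimes>\<^bsub>D\<^esub> h2 (x, y)
        \<otimes>\<^bsub>D\<^esub> act' x (h1 (y, z)) \<otimes>\<^bsub>D\<^esub> h1 (x, y \<otimes>\<^bsub>P\<^esub> z)"
  proof (intro ballI)
    fix x y z assume xyz: "x \<in> carrier P" "y \<in> carrier P" "z \<in> carrier P"
    show "k (x, y, z) \<otimes>\<^bsub>D\<^esub> h1 (x \<otimes>\<^bsub>P\<^esub> y, z) \<otimes>\<^bsub>D\<^esub> h1 (x, y)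
        \<otimes>\<^bsub>D\<^esub> act' x (h2 (y, z)) \<otimes>\<^bsub>D\<^esub> h2 (x, y \<otimes>\<^bsub>P\<^esub> z)
      = k' (x, y, z) \<otimes>\<^bsub>D\<^esub> h2 (x \<otimes>\<^bsub>P\<^esub> y, z) \<otimes>\<^bsub>D\<^esub> h2 (x, y)
        \<otimes>\<^bsub>D\<^esub> act' x (h1 (y, z)) \<otimes>\<^bsub>D\<^esub> h1 (x, y \<otimes>\<^bsub>P\<^esub> z)"
      using arg_cong [OF e [OF xyz], of j] xyz
      by (simp add: hom_mult [OF j(1)] c2 [OF g(1)] c2 [OF g(2)] c3 [OF f(1)] c3 [OF f(2)]
          act_closed eq h1_def h2_def k_def k'_def)
  qed
  with h k have "(k, k') \<in> cohomologous3 P D act'"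
    unfolding cohomologous3_def by blast
  then show ?thesis by (simp add: k_def k'_def)
qed

lemma (in group_semimodule) cohomologous3_one_if_H3_trivial:
  assumes H: "carrier (H3 P A act) = {\<one>\<^bsub>H3 P A act\<^esub>}" and f: "f \<in> cocycles3 P A act"
  shows "(f, cochain3_one P A) \<in> cohomologous3 P A act"
proof -
  have "cohomologous3 P A act `` {f} = cohomologous3 P A act `` {cochain3_one P A}"
    using H quotientI [OF f, of "cohomologous3 P A act"] by (simp add: H3_def)
  moreover have "f \<in> cohomologous3 P A act `` {f}"
    using equiv_class_self [OF equiv_cohomologous3 f] .
  ultimately have "(cochain3_one P A, f) \<in> cohomologous3 P A act" by simp
  then show ?thesis
    using equiv_cohomologous3 by (auto simp: equiv_def elim: symE)
qed


section \<open>Extensions from factor sets\<close>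

text \<open>The last assumption is the obstruction identity with trivial obstruction.\<close>

locale factor_set = abstract_kernel P G \<psi>
  for P (structure) and G (structure) and \<psi> +
  fixes \<phi> :: "'p \<Rightarrow> 'g \<Rightarrow> 'g" and f :: "'p \<times> 'p \<Rightarrow> 'g"
  constrains P :: "('p, 'm) monoid_scheme" and G :: "('g, 'n) monoid_scheme"
  assumes rep: "x \<in> carrier P \<Longrightarrow> \<phi> x \<in> \<psi> x"
    and rep_one: "\<phi> \<one>\<^bsub>P\<^esub> = \<one>\<^bsub>AutoGroup G\<^esub>"
    and factor_cochain: "f \<in> cochains2 P G"
    and rep_mult: "\<lbrakk>x \<in> carrier P; y \<in> carrier P\<rbrakk> \<Longrightarrow>
      \<phi> x \<otimes>\<^bsub>AutoGroup G\<^esub> \<phi> y = inner_aut G (f (x, y)) \<otimes>\<^bsub>AutoGroup G\<^esub> \<phi> (x \<otimes>\<^bsub>P\<^esub> y)"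
    and factor_identity: "\<lbrakk>x \<in> carrier P; y \<in> carrier P; z \<in> carrier P\<rbrakk> \<Longrightarrow>
      \<phi> x (f (y, z)) \<otimes>\<^bsub>G\<^esub> f (x, y \<otimes>\<^bsub>P\<^esub> z) = f (x, y) \<otimes>\<^bsub>G\<^esub> f (x \<otimes>\<^bsub>P\<^esub> y, z)"
begin

definition schreier_product :: "('g \<times> 'p) monoid"
  where "schreier_product = \<lparr>carrier = carrier G \<times> carrier P,
    mult = (\<lambda>(g, x) (h, y). (g \<otimes>\<^bsub>G\<^esub> \<phi> x h \<otimes>\<^bsub>G\<^esub> f (x, y), x \<otimes>\<^bsub>P\<^esub> y)),
    one = (\<one>\<^bsub>G\<^esub>, \<one>\<^bsub>P\<^esub>)\<rparr>"

lemma carrier_schreier [simp]: "carrier schreier_product = carrier G \<times> carrier P"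
  and one_schreier [simp]: "\<one>\<^bsub>schreier_product\<^esub> = (\<one>\<^bsub>G\<^esub>, \<one>\<^bsub>P\<^esub>)"
  and mult_schreier [simp]: "(g, x) \<otimes>\<^bsub>schreier_product\<^esub> (h, y)
    = (g \<otimes>\<^bsub>G\<^esub> \<phi> x h \<otimes>\<^bsub>G\<^esub> f (x, y), x \<otimes>\<^bsub>P\<^esub> y)"
  by (simp_all add: schreier_product_def)

lemma rep_auto: "x \<in> carrier P \<Longrightarrow> \<phi> x \<in> auto G"
  using psi_auto rep by blast

lemma rep_closed [simp]: "\<lbrakk>x \<in> carrier P; g \<in> carrier G\<rbrakk> \<Longrightarrow> \<phi> x g \<in> carrier G"
  using auto_closed rep_auto by metis

lemma rep_hom: "\<lbrakk>x \<in> carrier P; g \<in> carrier G; h \<in> carrier G\<rbrakk> \<Longrightarrow>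
    \<phi> x (g \<otimes>\<^bsub>G\<^esub> h) = \<phi> x g \<otimes>\<^bsub>G\<^esub> \<phi> x h"
  using auto_mult rep_auto by metis

lemma rep_id [simp]: "g \<in> carrier G \<Longrightarrow> \<phi> \<one>\<^bsub>P\<^esub> g = g"
  by (simp add: rep_one one_AutoGroup)

lemma factor_closed [simp]: "\<lbrakk>x \<in> carrier P; y \<in> carrier P\<rbrakk> \<Longrightarrow> f (x, y) \<in> carrier G"
  using factor_cochain by (auto simp: cochains2_def)

lemma factor_one [simp]:
  "x \<in> carrier P \<Longrightarrow> f (x, \<one>\<^bsub>P\<^esub>) = \<one>\<^bsub>G\<^esub>" "x \<in> carrier P \<Longrightarrow> f (\<one>\<^bsub>P\<^esub>, x) = \<one>\<^bsub>G\<^esub>"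
  using factor_cochain by (auto simp: cochains2_def)

lemma rep_rep_factor:
  assumes "x \<in> carrier P" "y \<in> carrier P" "g \<in> carrier G"
  shows "\<phi> x (\<phi> y g) \<otimes>\<^bsub>G\<^esub> f (x, y) = f (x, y) \<otimes>\<^bsub>G\<^esub> \<phi> (x \<otimes>\<^bsub>P\<^esub> y) g"
proof -
  have "(\<phi> x \<otimes>\<^bsub>AutoGroup G\<^esub> \<phi> y) g
      = (inner_aut G (f (x, y)) \<otimes>\<^bsub>AutoGroup G\<^esub> \<phi> (x \<otimes>\<^bsub>P\<^esub> y)) g"
    using rep_mult assms by simp
  then have "\<phi> x (\<phi> y g) = f (x, y) \<otimes>\<^bsub>G\<^esub> \<phi> (x \<otimes>\<^bsub>P\<^esub> y) g \<otimes>\<^bsub>G\<^esub> inv\<^bsub>G\<^esub> f (x, y)"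
    using assms
    by (simp add: mult_AutoGroup rep_auto G.inner_aut_auto compose_eq) (simp add: inner_aut_def)
  then show ?thesis using assms by (simp add: G.m_assoc)
qed

text \<open>Moving \<open>\<phi> x (\<phi> y h)\<close> past \<open>f (x, y)\<close> and using the factor set identity brings the two
  ways of bracketing a product of three elements to the same form.\<close>

lemma group_schreier: "group schreier_product"
proof (rule groupI)
  fix a b c
  assume "a \<in> carrier schreier_product" "b \<in> carrier schreier_product"
    "c \<in> carrier schreier_product"
  then obtain g x h y k z where abc: "a = (g, x)" "b = (h, y)" "c = (k, z)"
    and G: "g \<in> carrier G" "h \<in> carrier G" "k \<in> carrier G"
    and x: "x \<in> carrier P" and y: "y \<in> carrier P" and z: "z \<in> carrier P" by auto
  let ?xy = "x \<otimes>\<^bsub>P\<^esub> y"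
  have "g \<otimes>\<^bsub>G\<^esub> \<phi> x (h \<otimes>\<^bsub>G\<^esub> \<phi> y k \<otimes>\<^bsub>G\<^esub> f (y, z)) \<otimes>\<^bsub>G\<^esub> f (x, y \<otimes>\<^bsub>P\<^esub> z)
      = g \<otimes>\<^bsub>G\<^esub> \<phi> x h \<otimes>\<^bsub>G\<^esub> \<phi> x (\<phi> y k) \<otimes>\<^bsub>G\<^esub> (\<phi> x (f (y, z)) \<otimes>\<^bsub>G\<^esub> f (x, y \<otimes>\<^bsub>P\<^esub> z))"
    using G x y z by (simp add: rep_hom G.m_assoc)
  also have "\<dots> = g \<otimes>\<^bsub>G\<^esub> \<phi> x h \<otimes>\<^bsub>G\<^esub> (\<phi> x (\<phi> y k) \<otimes>\<^bsub>G\<^esub> f (x, y)) \<otimes>\<^bsub>G\<^esub> f (?xy, z)"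
    using G x y z by (simp add: factor_identity G.m_assoc)
  also have "\<dots> = g \<otimes>\<^bsub>G\<^esub> \<phi> x h \<otimes>\<^bsub>G\<^esub> f (x, y) \<otimes>\<^bsub>G\<^esub> \<phi> ?xy k \<otimes>\<^bsub>G\<^esub> f (?xy, z)"
    using G x y z by (simp add: rep_rep_factor G.m_assoc)
  finally show "a \<otimes>\<^bsub>schreier_product\<^esub> b \<otimes>\<^bsub>schreier_product\<^esub> c
      = a \<otimes>\<^bsub>schreier_product\<^esub> (b \<otimes>\<^bsub>schreier_product\<^esub> c)"
    using x y z by (simp add: abc P.m_assoc)
next
  fix a assume "a \<in> carrier schreier_product"
  then obtain g x where a: "a = (g, x)" "g \<in> carrier G" "x \<in> carrier P" by auto
  let ?x = "inv\<^bsub>P\<^esub> x"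
  \<comment> \<open>The first component solves \<open>h \<cdot> \<phi> (inv x) g \<cdot> f (inv x, x) = 1\<close> for \<open>h\<close>.\<close>
  have "(inv\<^bsub>G\<^esub> (\<phi> ?x g \<otimes>\<^bsub>G\<^esub> f (?x, x)), ?x) \<otimes>\<^bsub>schreier_product\<^esub> a = \<one>\<^bsub>schreier_product\<^esub>"
    using a by (simp add: G.m_assoc)
  moreover have "(inv\<^bsub>G\<^esub> (\<phi> ?x g \<otimes>\<^bsub>G\<^esub> f (?x, x)), ?x) \<in> carrier schreier_product"
    using a by simp
  ultimately show "\<exists>b\<in>carrier schreier_product.
      b \<otimes>\<^bsub>schreier_product\<^esub> a = \<one>\<^bsub>schreier_product\<^esub>" by blast
qed auto

lemma group_extension_schreier:
  "group_extension P G schreier_product (\<lambda>g. (g, \<one>\<^bsub>P\<^esub>)) snd"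
proof -
  let ?i = "\<lambda>g. (g, \<one>\<^bsub>P\<^esub>)"
  have "?i \<in> mon G schreier_product"
    by (simp add: mon_def hom_def inj_on_def)
  moreover have "snd \<in> hom schreier_product P"
    by (rule homI) auto
  moreover have "snd ` carrier schreier_product = carrier P" by force
  moreover have "kernel schreier_product P snd = ?i ` carrier G"
    by (auto simp: kernel_def)
  ultimately show ?thesis
    unfolding group_extension_def epi_def
    using group_schreier P.is_group G.is_group by blast
qed

lemma conj_aut_schreier:
  assumes g: "g \<in> carrier G" and x: "x \<in> carrier P"
  shows "conj_aut G schreier_product (\<lambda>g. (g, \<one>\<^bsub>P\<^esub>)) (g, x)
    = inner_aut G g \<otimes>\<^bsub>AutoGroup G\<^esub> \<phi> x"
proof -
  interpret B: group schreier_product by (rule group_schreier)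
  let ?i = "\<lambda>g. (g, \<one>\<^bsub>P\<^esub>)"
  have inj: "inj_on ?i (carrier G)" by (simp add: inj_on_def)
  have "(g, x) \<otimes>\<^bsub>schreier_product\<^esub> ?i h \<otimes>\<^bsub>schreier_product\<^esub> inv\<^bsub>schreier_product\<^esub> (g, x)
      = ?i (g \<otimes>\<^bsub>G\<^esub> \<phi> x h \<otimes>\<^bsub>G\<^esub> inv\<^bsub>G\<^esub> g)" if h: "h \<in> carrier G" for h
  proof -
    have "(g, x) \<otimes>\<^bsub>schreier_product\<^esub> ?i h
        = ?i (g \<otimes>\<^bsub>G\<^esub> \<phi> x h \<otimes>\<^bsub>G\<^esub> inv\<^bsub>G\<^esub> g) \<otimes>\<^bsub>schreier_product\<^esub> (g, x)"
      using g x h by (simp add: G.m_assoc)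
    moreover have "?i (g \<otimes>\<^bsub>G\<^esub> \<phi> x h \<otimes>\<^bsub>G\<^esub> inv\<^bsub>G\<^esub> g) \<in> carrier schreier_product"
      "(g, x) \<in> carrier schreier_product" using g x h by simp_all
    ultimately show ?thesis
      by (metis B.inv_closed B.m_assoc B.r_inv B.r_one)
  qed
  then have "conj_aut G schreier_product ?i (g, x)
      = (\<lambda>h\<in>carrier G. g \<otimes>\<^bsub>G\<^esub> \<phi> x h \<otimes>\<^bsub>G\<^esub> inv\<^bsub>G\<^esub> g)"
    using g x unfolding conj_aut_def
    by (intro restrict_ext) (simp add: inv_into_f_f [OF inj])
  also have "\<dots> = compose (carrier G) (inner_aut G g) (\<phi> x)"
    using x by (auto simp: compose_def inner_aut_def)
  finally show ?thesis using g x by (simp add: mult_AutoGroup rep_auto G.inner_aut_auto)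
qed

lemma extension_of_kernel_schreier:
  "extension_of_kernel P G \<psi> schreier_product (\<lambda>g. (g, \<one>\<^bsub>P\<^esub>)) snd"
proof -
  have "\<psi> x = Inn G #>\<^bsub>AutoGroup G\<^esub> conj_aut G schreier_product (\<lambda>g. (g, \<one>\<^bsub>P\<^esub>)) (g, x)"
    if g: "g \<in> carrier G" and x: "x \<in> carrier P" for g x
  proof (rule psi_eq [OF x])
    show "conj_aut G schreier_product (\<lambda>g. (g, \<one>\<^bsub>P\<^esub>)) (g, x) \<in> \<psi> x"
      using g unfolding conj_aut_schreier [OF g x] psi_eq [OF x rep [OF x]]
      by (auto simp: r_coset_def Inn_def)
  qed
  then show ?thesis
    using group_extension_schreier by (auto simp: extension_of_kernel_def)
qed

end


section \<open>Vanishing of the obstruction\<close>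

context abstract_kernel
begin

lemma inner_aut_centre_mult:
  assumes "c \<in> centre G" "g \<in> carrier G"
  shows "inner_aut G (c \<otimes>\<^bsub>G\<^esub> g) = inner_aut G g"
proof -
  have c: "c \<in> carrier G" using assms(1) by (rule centre_closed)
  have "c \<otimes>\<^bsub>G\<^esub> h \<otimes>\<^bsub>G\<^esub> inv\<^bsub>G\<^esub> c = h" if h: "h \<in> carrier G" for h
  proof -
    have "c \<otimes>\<^bsub>G\<^esub> h \<otimes>\<^bsub>G\<^esub> inv\<^bsub>G\<^esub> c = h \<otimes>\<^bsub>G\<^esub> c \<otimes>\<^bsub>G\<^esub> inv\<^bsub>G\<^esub> c"
      by (simp only: centre_comm [OF assms(1) h])
    also have "\<dots> = h" using c h by (simp add: G.m_assoc)
    finally show ?thesis .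
  qed
  then have "inner_aut G c = \<one>\<^bsub>AutoGroup G\<^esub>"
    by (simp add: inner_aut_def one_AutoGroup cong: restrict_cong)
  then show ?thesis
    using G.inner_aut_mult [OF c assms(2)] monoid.l_one [OF group.is_monoid [OF G.AutoGroup]]
      G.inner_aut_auto [OF assms(2)]
    by simp
qed

text \<open>If the obstruction cocycle is a coboundary, the cochain \<open>f\<close> can be corrected by central
  elements so as to become a factor set.\<close>

lemma extension_if_obstruction_trivial:
  assumes k: "obstruction_cocycle P G \<psi> \<phi> f k"
    and triv: "(k, cochain3_one P (centre_group G))
      \<in> cohomologous3 P (centre_group G) (centre_act \<psi>)"
  shows "has_extension P G \<psi>"
proof -
  interpret Z: group_module P "centre_group G" "centre_act \<psi>" by (rule group_module_centre)
  obtain g where g: "g \<in> cochains2 P (centre_group G)"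
    and e: "\<And>x y z. x \<in> carrier P \<Longrightarrow> y \<in> carrier P \<Longrightarrow> z \<in> carrier P \<Longrightarrow>
      k (x, y, z) \<otimes>\<^bsub>G\<^esub> centre_act \<psi> x (g (y, z)) \<otimes>\<^bsub>G\<^esub> g (x, y \<otimes>\<^bsub>P\<^esub> z)
      = \<one>\<^bsub>G\<^esub> \<otimes>\<^bsub>G\<^esub> g (x \<otimes>\<^bsub>P\<^esub> y, z) \<otimes>\<^bsub>G\<^esub> g (x, y)"
    using triv unfolding Z.cohomologous3_iff by (auto simp: cochain3_one_def)
  have \<phi>: "\<phi> x \<in> \<psi> x" if "x \<in> carrier P" for x
    using k that by (simp add: obstruction_cocycle_def)
  have \<phi>1: "\<phi> \<one>\<^bsub>P\<^esub> = \<one>\<^bsub>AutoGroup G\<^esub>" and f: "f \<in> cochains2 P G"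
    and kc: "k \<in> cocycles3 P (centre_group G) (centre_act \<psi>)"
    using k by (simp_all add: obstruction_cocycle_def)
  have a: "\<phi> x \<in> auto G" if "x \<in> carrier P" for x
    using psi_auto \<phi> that by blast
  have F: "f (x, y) \<in> carrier G" if "x \<in> carrier P" "y \<in> carrier P" for x y
    using f that by (auto simp: cochains2_def)
  have gZ: "g (x, y) \<in> centre G" if "x \<in> carrier P" "y \<in> carrier P" for x y
    using g that by (auto simp: cochains2_def)
  have gG: "g (x, y) \<in> carrier G" if "x \<in> carrier P" "y \<in> carrier P" for x y
    using gZ [OF that] by (rule centre_closed)
  have kZ: "k (x, y, z) \<in> centre G" if "x \<in> carrier P" "y \<in> carrier P" "z \<in> carrier P" for x y z
    using kc that by (auto simp: cocycles3_def cochains3_def)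
  define f' where "f' = (\<lambda>t\<in>carrier P \<times> carrier P. g t \<otimes>\<^bsub>G\<^esub> f t)"
  have f': "f' \<in> cochains2 P G"
    using f g gG by (auto simp: cochains2_def f'_def)
  have "factor_set P G \<psi> \<phi> f'"
  proof unfold_locales
    fix x y assume x: "x \<in> carrier P" and y: "y \<in> carrier P"
    show "\<phi> x \<otimes>\<^bsub>AutoGroup G\<^esub> \<phi> y = inner_aut G (f' (x, y)) \<otimes>\<^bsub>AutoGroup G\<^esub> \<phi> (x \<otimes>\<^bsub>P\<^esub> y)"
      using k x y by (simp add: obstruction_cocycle_def f'_def inner_aut_centre_mult gZ F)
  next
    fix x y z assume x: "x \<in> carrier P" and y: "y \<in> carrier P" and z: "z \<in> carrier P"
    have \<phi>g: "\<phi> x (g (y, z)) \<in> centre G" using G.auto_centre a gZ x y z by blast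
    note cl = x y z F gG centre_closed [OF \<phi>g] centre_closed [OF kZ] a auto_closed [OF a]
    let ?a = "\<phi> x (g (y, z))" and ?b = "g (x, y \<otimes>\<^bsub>P\<^esub> z)" and ?k = "k (x, y, z)"
    have Z_ac: "c \<otimes>\<^bsub>G\<^esub> (d \<otimes>\<^bsub>G\<^esub> h) = d \<otimes>\<^bsub>G\<^esub> (c \<otimes>\<^bsub>G\<^esub> h)"
      if "c \<in> centre G" "d \<in> carrier G" "h \<in> carrier G" for c d h
      using that centre_closed [of c G] centre_comm [of c G d] by (simp flip: G.m_assoc)
    have "\<phi> x (f' (y, z)) \<otimes>\<^bsub>G\<^esub> f' (x, y \<otimes>\<^bsub>P\<^esub> z)
        = ?a \<otimes>\<^bsub>G\<^esub> (\<phi> x (f (y, z)) \<otimes>\<^bsub>G\<^esub> (?b \<otimes>\<^bsub>G\<^esub> f (x, y \<otimes>\<^bsub>P\<^esub> z)))"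
      by (simp add: f'_def cl auto_mult [OF a] G.m_assoc)
    also have "\<dots> = ?a \<otimes>\<^bsub>G\<^esub> (?b \<otimes>\<^bsub>G\<^esub> (\<phi> x (f (y, z)) \<otimes>\<^bsub>G\<^esub> f (x, y \<otimes>\<^bsub>P\<^esub> z)))"
      using Z_ac [OF gZ [OF x P.m_closed [OF y z]]] by (simp add: cl)
    also have "\<dots> = ?a \<otimes>\<^bsub>G\<^esub> (?b \<otimes>\<^bsub>G\<^esub> (?k \<otimes>\<^bsub>G\<^esub> f (x, y) \<otimes>\<^bsub>G\<^esub> f (x \<otimes>\<^bsub>P\<^esub> y, z)))"
      using k x y z by (simp add: obstruction_cocycle_def)
    also have "\<dots> = (?k \<otimes>\<^bsub>G\<^esub> ?a \<otimes>\<^bsub>G\<^esub> ?b) \<otimes>\<^bsub>G\<^esub> (f (x, y) \<otimes>\<^bsub>G\<^esub> f (x \<otimes>\<^bsub>P\<^esub> y, z))"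
      by (simp add: cl G.m_assoc Z_ac [OF kZ [OF x y z]])
    also have "\<dots> = g (x \<otimes>\<^bsub>P\<^esub> y, z) \<otimes>\<^bsub>G\<^esub> (g (x, y) \<otimes>\<^bsub>G\<^esub> (f (x, y) \<otimes>\<^bsub>G\<^esub> f (x \<otimes>\<^bsub>P\<^esub> y, z)))"
      using e [OF x y z] centre_act_eq [OF x \<phi> [OF x] gZ [OF y z]] by (simp add: cl G.m_assoc)
    also have "\<dots> = f' (x, y) \<otimes>\<^bsub>G\<^esub> f' (x \<otimes>\<^bsub>P\<^esub> y, z)"
      by (simp add: f'_def cl G.m_assoc Z_ac [OF gZ [OF P.m_closed [OF x y] z]])
    finally show "\<phi> x (f' (y, z)) \<otimes>\<^bsub>G\<^esub> f' (x, y \<otimes>\<^bsub>P\<^esub> z) = f' (x, y) \<otimes>\<^bsub>G\<^esub> f' (x \<otimes>\<^bsub>P\<^esub> y, z)" .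
  qed (use \<phi> \<phi>1 f' in auto)
  then show ?thesis
    unfolding has_extension_def by (blast dest: factor_set.extension_of_kernel_schreier)
qed

lemma Obs_cocycle:
  obtains \<phi> f k where "obstruction_cocycle P G \<psi> \<phi> f k"
    "Obs P G \<psi> = cohomologous3 P (centre_group G) (centre_act \<psi>) `` {k}"
proof -
  have "\<exists>k \<phi> f. obstruction_cocycle P G \<psi> \<phi> f k"
    using obstruction_data_exists obstruction_cocycle_unique_exists by metis
  from someI_ex [OF this] that show ?thesis unfolding Obs_def by blast
qed

end

theorem proposition5p2:
  fixes P :: "'p monoid" and C :: "'c monoid" and act :: "'p \<Rightarrow> 'c \<Rightarrow> 'c" and A :: "'c set"
    and G :: "'g monoid" and \<psi> :: "'p \<Rightarrow> ('g \<Rightarrow> 'g) set" and j :: "'c \<Rightarrow> 'g"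
  assumes "group_module P C act"
    and "subsemimodule P A C act"
    and "group_completion_of C A"
    and "carrier (H3 P (C\<lparr>carrier := A\<rparr>) act) = {\<one>\<^bsub>H3 P (C\<lparr>carrier := A\<rparr>) act\<^esub>}"
    and "abstract_kernel P G \<psi>"
    and "j \<in> module_iso P C act (centre_group G) (centre_act \<psi>)"
    and "\<exists>f\<in>cocycles3 P (C\<lparr>carrier := A\<rparr>) act.
      (\<lambda>t\<in>carrier P \<times> carrier P \<times> carrier P. j (f t)) \<in> Obs P G \<psi>"
  shows "has_extension P G \<psi>"
proof -
  interpret C: group_module P C act by fact
  interpret A: group_semimodule P "C\<lparr>carrier := A\<rparr>" act
    using C.group_semimodule_axioms assms(2) by (rule subsemimodule_is_semimodule)
  interpret K: abstract_kernel P G \<psi> by fact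
  interpret Z: group_module P "centre_group G" "centre_act \<psi>" by (rule K.group_module_centre)
  let ?ZG = "centre_group G" and ?za = "centre_act \<psi>"
  obtain f where f: "f \<in> cocycles3 P (C\<lparr>carrier := A\<rparr>) act"
    and fO: "(\<lambda>t\<in>carrier P \<times> carrier P \<times> carrier P. j (f t)) \<in> Obs P G \<psi>"
    using assms(7) by blast
  have sub: "A \<subseteq> carrier C"
    using assms(2) submonoid.subset by (auto simp: subsemimodule_def)
  have jC: "j \<in> hom C ?ZG"
    and eq: "\<And>x c. \<lbrakk>x \<in> carrier P; c \<in> carrier C\<rbrakk> \<Longrightarrow> j (act x c) = ?za x (j c)"
    using assms(6) by (auto simp: module_iso_def iso_def)
  have j1: "j \<one>\<^bsub>C\<^esub> = \<one>\<^bsub>G\<^esub>"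
    using hom_one [OF jC C.A.is_group Z.A.is_group] by simp
  have jA: "j \<in> hom (C\<lparr>carrier := A\<rparr>) ?ZG"
    using jC sub by (auto simp: hom_def)
  have "(f, cochain3_one P (C\<lparr>carrier := A\<rparr>)) \<in> cohomologous3 P (C\<lparr>carrier := A\<rparr>) act"
    using assms(4) f by (rule A.cohomologous3_one_if_H3_trivial)
  from cohomologous3_image [OF A.group_semimodule_axioms jA _ _ this, of ?za] j1 eq sub
  have "(\<lambda>t\<in>carrier P \<times> carrier P \<times> carrier P. j (f t),
      \<lambda>t\<in>carrier P \<times> carrier P \<times> carrier P. j (cochain3_one P (C\<lparr>carrier := A\<rparr>) t))
      \<in> cohomologous3 P ?ZG ?za"
    by auto
  also have "(\<lambda>t\<in>carrier P \<times> carrier P \<times> carrier P. j (cochain3_one P (C\<lparr>carrier := A\<rparr>) t))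
      = cochain3_one P ?ZG"
    by (auto simp: cochain3_one_def j1)
  finally have f1: "(\<lambda>t\<in>carrier P \<times> carrier P \<times> carrier P. j (f t), cochain3_one P ?ZG)
      \<in> cohomologous3 P ?ZG ?za" .
  obtain \<phi> h k where k: "obstruction_cocycle P G \<psi> \<phi> h k"
    and "Obs P G \<psi> = cohomologous3 P ?ZG ?za `` {k}"
    by (rule K.Obs_cocycle)
  with fO have "(k, \<lambda>t\<in>carrier P \<times> carrier P \<times> carrier P. j (f t)) \<in> cohomologous3 P ?ZG ?za"
    by simp
  with f1 have "(k, cochain3_one P ?ZG) \<in> cohomologous3 P ?ZG ?za"
    using Z.equiv_cohomologous3 by (meson equivE transE)
  with k show ?thesis by (rule K.extension_if_obstruction_trivial)
qed

end
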